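(* Let $f$ and $g$ be arithmetical functions with absolutely convergent Ramanujan expansions $$f(n)=\sum_{r\ge1}\hat f(r)c_r(n),\qquad g(n)=\sum_{s\ge1}\hat g(s)c_s(n)\quad(n\ge1),$$ and suppose there is $\delta>0$ such that $|\hat f(r)|,|\hat g(r)|\ll r^{-1-\delta}$ for all $r\ge1$. Let $h$ be a positive integer. Then for positive integers $N$ (with $N\ge2$), as $N\to\infty$, $$\sum_{n\le N} f(n)g(n+h)=\begin{cases} N\sum_{r\ge1}\hat f(r)\hat g(r)c_r(h)+O\big(N^{1-\delta}(\log N)^{4-2\delta}\big) & \text{if } \delta<1,\\ N\sum_{r\ge1}\hat f(r)\hat g(r)c_r(h)+O(\log^3 N) & \text{if } \delta=1,\\ N\sum_{r\ge1}\hat f(r)\hat g(r)c_r(h)+O(1) & \text{if } \delta>1.\end{cases}$$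
   Context: For positive integers $r,n$, the Ramanujan sum is $c_r(n)=\sum_{a\in(\mathbb Z/r\mathbb Z)^*}\zeta_r^{an}$ with $\zeta_r$ a primitive $r$-th root of unity; equivalently $c_r(n)=\sum_{d\mid n,\,d\mid r}\mu(r/d)d$. An arithmetical function $f$ has a Ramanujan expansion with coefficients $\hat f(r)\in\mathbb C$ if $f(n)=\sum_{r\ge1}\hat f(r)c_r(n)$ for every $n\ge1$; it is absolutely convergent if the series converges absolutely for each $n$. *)

theory Defs
  imports "HOL-Analysis.Analysis" "HOL-Number_Theory.Totient"
begin

text \<open>
  The set \<open>totatives r\<close> is the set of \<open>a\<close> in \<open>{1..r}\<close> coprime to \<open>r\<close>, a system of
  representatives of the units modulo \<open>r\<close> (for \<open>r = 1\<close> it is \<open>{1}\<close>), and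
  \<open>cis (2 * pi / r)\<close> is the primitive root of unity \<open>exp (2 * pi * \<i> / r)\<close>.
\<close>

definition ramanujan_sum :: "nat \<Rightarrow> nat \<Rightarrow> complex" where
  "ramanujan_sum r n = (\<Sum>a\<in>totatives r. cis (2 * pi / real r) ^ (a * n))"

text \<open>
  Arithmetical functions and coefficient sequences live on the positive integers; they are
  modelled as functions on \<open>nat\<close> whose value at \<open>0\<close> is irrelevant.  Series over
  \<open>r \<ge> 1\<close> are therefore indexed by \<open>r = Suc k\<close>.
\<close>

definition has_ramanujan_expansion :: "(nat \<Rightarrow> complex) \<Rightarrow> (nat \<Rightarrow> complex) \<Rightarrow> bool" where
  "has_ramanujan_expansion f fhat \<longleftrightarrow>
     (\<forall>n\<ge>1. (\<lambda>k. fhat (Suc k) * ramanujan_sum (Suc k) n) sums f n)"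

definition has_abs_convergent_ramanujan_expansion ::
    "(nat \<Rightarrow> complex) \<Rightarrow> (nat \<Rightarrow> complex) \<Rightarrow> bool" where
  "has_abs_convergent_ramanujan_expansion f fhat \<longleftrightarrow>
     has_ramanujan_expansion f fhat \<and>
     (\<forall>n\<ge>1. summable (\<lambda>k. norm (fhat (Suc k) * ramanujan_sum (Suc k) n)))"

definition shifted_convolution_error ::
    "(nat \<Rightarrow> complex) \<Rightarrow> (nat \<Rightarrow> complex) \<Rightarrow> (nat \<Rightarrow> complex) \<Rightarrow> (nat \<Rightarrow> complex) \<Rightarrow>
      nat \<Rightarrow> nat \<Rightarrow> complex" where
  "shifted_convolution_error f fhat g ghat h N =
     (\<Sum>n=1..N. f n * g (n + h)) -
     of_nat N * (\<Sum>k. fhat (Suc k) * ghat (Suc k) * ramanujan_sum (Suc k) h)"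

end

(*
  Let F(d) = d * sum_m mu(m) fhat(d m), and define G from ghat in the same way. Since
  c_r(n) = sum_{d | r, d | n} mu(r/d) d, we have f(n) = sum_{d | n} F(d), and Moebius inversion gives
  fhat(q) = sum_t F(q t) / (q t). Hence sum_{n <= N} f(n) g(n+h) = sum_{d,e} F(d) G(e) A(d,e), where
  A(d,e) counts the n <= N with d | n and e | n+h. The expected value of A(d,e) is N kappa(d,e),
  with kappa(d,e) = gcd(d,e) / (d e) if gcd(d,e) | h and 0 otherwise, and |A - N kappa| <= 1.
  As sum_{q | k} c_q(h) is k if k | h and 0 otherwise, replacing A by N kappa produces exactly
  N sum_q fhat(q) ghat(q) c_q(h). The error is at most sum_{d,e} (d e)^(-delta) |A - N kappa| up to
  a constant. For delta > 1 the bound 1 suffices. For delta <= 1 it is used for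
  d e <= U = N (1 + log N)^2 only; beyond U, the sum of A is at most
  sum_{n <= N} tau(n) tau(n+h) << N log^3 N, and kappa <= h / (d e).
*)
theory Submission
  imports Defs "HOL-Computational_Algebra.Squarefree"
begin

section \<open>The Moebius function and its divisor sums\<close>

definition moebius :: "nat \<Rightarrow> int" where
  "moebius n = (if squarefree n then (- 1) ^ card (prime_factors n) else 0)"

lemma moebius_1 [simp]: "moebius (Suc 0) = 1"
  by (simp add: moebius_def flip: One_nat_def)

lemma abs_moebius_le: "\<bar>moebius n\<bar> \<le> 1"
  by (simp add: moebius_def power_abs)

lemma moebius_prime_mult:
  assumes p: "prime p" and pd: "\<not> p dvd d"
  shows "moebius (p * d) = - moebius d"
proof -
  have d0: "d \<noteq> 0" using pd by (intro notI) auto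
  have cop: "coprime p d" using p pd by (simp add: prime_imp_coprime)
  have "squarefree (p * d) \<longleftrightarrow> squarefree d"
    using squarefree_mult_coprime[OF cop] squarefree_multD(2)[of p d] p by (auto simp: squarefree_prime)
  moreover have "prime_factors (p * d) = insert p (prime_factors d)"
    using p d0 by (simp add: prime_factors_product prime_prime_factors)
  moreover have "p \<notin> prime_factors d" using pd by (auto dest: in_prime_factors_imp_dvd)
  ultimately show ?thesis by (simp add: moebius_def)
qed

text \<open>Only squarefree divisors contribute. For a fixed prime p dividing n, the map d to p * d
  pairs the squarefree divisors prime to p with those divisible by p, and it flips the sign of
  \<open>moebius\<close>, so everything cancels.\<close>

lemma sum_moebius_divisors:
  assumes "n > 0"
  shows "(\<Sum>d | d dvd n. moebius d) = (if n = 1 then 1 else 0)"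
proof (cases "n = 1")
  case False
  then obtain p where p: "prime p" "p dvd n" using prime_factor_nat by blast
  let ?D = "{d. d dvd n}" and ?A = "{d. d dvd n \<and> \<not> p dvd d}"
    and ?S = "{d. d dvd n \<and> squarefree d}"
  have fin: "finite ?D" using assms by simp
  have "(\<Sum>d\<in>?D. moebius d) = (\<Sum>d\<in>?S. moebius d)"
    by (rule sum.mono_neutral_right[OF fin]) (auto simp: moebius_def)
  also have "?S = {d\<in>?S. \<not> p dvd d} \<union> {d\<in>?S. p dvd d}" by auto
  also have "(\<Sum>d\<in>\<dots>. moebius d) = (\<Sum>d\<in>{d\<in>?S. \<not> p dvd d}. moebius d) + (\<Sum>d\<in>{d\<in>?S. p dvd d}. moebius d)"
    using fin by (intro sum.union_disjoint) auto
  also have "(\<Sum>d\<in>{d\<in>?S. p dvd d}. moebius d) = (\<Sum>d\<in>{d\<in>?S. \<not> p dvd d}. - moebius d)"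
  proof (rule sum.reindex_bij_witness[of _ "\<lambda>d. p * d" "\<lambda>d. d div p"], goal_cases)
    case (1 a) then show ?case by auto
  next
    case (2 a)
    then obtain k where k: "a = p * k" by auto
    have p0: "p > 0" using p by (simp add: prime_gt_0_nat)
    have "\<not> p dvd k"
    proof
      assume "p dvd k"
      then have "p ^ 2 dvd a" using k by (auto simp: power2_eq_square)
      then show False using 2 squarefreeD[of a p] p by auto
    qed
    then show ?case using 2 k p0 squarefree_multD(2)[of p k] by (auto dest: dvd_mult_right)
  next
    case (3 b) then show ?case using p by (simp add: prime_gt_0_nat)
  next
    case (4 b)
    then have "p * b dvd n" using p by (intro divides_mult) (auto simp: prime_imp_coprime)
    moreover have "squarefree (p * b)" using 4 p
      by (intro squarefree_mult_coprime) (auto simp: prime_imp_coprime squarefree_prime)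
    ultimately show ?case by auto
  next
    case (5 a)
    then obtain k where k: "a = p * k" by auto
    have p0: "p > 0" using p by (simp add: prime_gt_0_nat)
    have "\<not> p dvd k"
    proof
      assume "p dvd k"
      then have "p ^ 2 dvd a" using k by (auto simp: power2_eq_square)
      then show False using 5 squarefreeD[of a p] p by auto
    qed
    then show ?case using k p0 moebius_prime_mult[OF p(1)] by simp
  qed
  finally show ?thesis using False by (simp add: sum_negf)
qed simp

section \<open>Ramanujan sums and their divisor formulas\<close>

text \<open>The terms form a geometric progression whose ratio \<open>?w\<close> is a k-th root of
  unity, equal to 1 exactly when k divides n.\<close>

lemma sum_roots_of_unity_powers:
  assumes "k > 0"
  shows "(\<Sum>j=1..k. cis (2 * pi / real k) ^ (j * n)) = (if k dvd n then of_nat k else 0)"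
proof -
  let ?w = "cis (2 * pi / real k) ^ n"
  have wk: "?w ^ k = 1"
    using assms by (simp add: Complex.DeMoivre field_simps flip: power_mult)
      (metis cis_multiple_2pi Ints_of_nat mult.assoc mult.commute)
  have "cis (2 * pi / real k) ^ (Suc j * n) = ?w * ?w ^ j" for j
    by (metis mult.commute power_Suc power_mult)
  then have eq: "(\<Sum>j=1..k. cis (2 * pi / real k) ^ (j * n)) = ?w * (\<Sum>j<k. ?w ^ j)"
    unfolding One_nat_def sum.atLeast1_atMost_eq sum_distrib_left by (rule sum.cong[OF refl])
  have one: "?w = 1 \<longleftrightarrow> k dvd n"
  proof
    assume "k dvd n"
    then obtain m where "n = k * m" by auto
    then have "?w = cis (2 * pi * real m)" using assms by (simp add: Complex.DeMoivre field_simps)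
    then show "?w = 1" by (simp add: cis_multiple_2pi)
  next
    assume "?w = 1"
    then have "cos (2 * pi * real n / real k) = 1"
      by (simp add: Complex.DeMoivre complex_eq_iff field_simps)
    then obtain m :: int where "2 * pi * real n / real k = of_int m * 2 * pi"
      using cos_one_2pi_int by blast
    then have "real n = of_int m * real k" using assms by (simp add: field_simps)
    then have "int n = m * int k" by (metis of_int_eq_iff of_int_mult of_int_of_nat_eq)
    then show "k dvd n" by (metis dvd_triv_right int_dvd_int_iff)
  qed
  show ?thesis
  proof (cases "k dvd n")
    case True
    then show ?thesis using eq one by simp
  next
    case False
    then have "?w \<noteq> 1" using one by simp
    then have "(\<Sum>j<k. ?w ^ j) = 0" using wk by (simp add: sum_gp_strict)
    then show ?thesis using eq False by simp
  qed
qed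

text \<open>Sort the exponents j in the complete sum by d = gcd(j, k). With j = a * d, the d-th
  power of the k-th root of unity is a primitive root of order k / d, so each class contributes one
  Ramanujan sum.\<close>

lemma sum_ramanujan_sum_divisors:
  assumes k: "k > 0"
  shows "(\<Sum>q | q dvd k. ramanujan_sum q n) = (if k dvd n then of_nat k else 0)"
proof -
  let ?A = "\<lambda>d. {j\<in>{0<..k}. gcd j k = d}"
  have "(\<Sum>j=1..k. cis (2 * pi / real k) ^ (j * n)) = (\<Sum>j\<in>(\<Union>d\<in>{d. d dvd k}. ?A d). cis (2 * pi / real k) ^ (j * n))"
    by (rule sum.cong) auto
  also have "\<dots> = (\<Sum>d | d dvd k. \<Sum>j\<in>?A d. cis (2 * pi / real k) ^ (j * n))"
    using k by (intro sum.UNION_disjoint) auto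
  also have "\<dots> = (\<Sum>d | d dvd k. ramanujan_sum (k div d) n)"
  proof (rule sum.cong[OF refl], goal_cases)
    case (1 d)
    then have d: "d dvd k" "d > 0" using k by (auto intro: dvd_pos_nat)
    have "(\<Sum>j\<in>?A d. cis (2 * pi / real k) ^ (j * n)) = (\<Sum>a\<in>totatives (k div d). cis (2 * pi / real k) ^ (a * d * n))"
      using sum.reindex_bij_betw[OF bij_betw_totatives_gcd_eq[OF d(1) k], of "\<lambda>j. cis (2 * pi / real k) ^ (j * n)"]
      by simp
    also have "\<dots> = ramanujan_sum (k div d) n"
      unfolding ramanujan_sum_def
    proof (rule sum.cong[OF refl])
      fix a
      obtain m where m: "k = d * m" using d by auto
      show "cis (2 * pi / real k) ^ (a * d * n) = cis (2 * pi / real (k div d)) ^ (a * n)"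
        using d k by (simp add: m Complex.DeMoivre field_simps)
    qed
    finally show ?case .
  qed
  also have "\<dots> = (\<Sum>q | q dvd k. ramanujan_sum q n)"
    using k by (intro sum.reindex_bij_witness[of _ "(div) k" "(div) k"]) (auto elim: dvdE)
  finally show ?thesis using sum_roots_of_unity_powers[OF k, of n] by simp
qed

lemma norm_ramanujan_sum_le: "norm (ramanujan_sum q n) \<le> real q"
proof -
  have "norm (ramanujan_sum q n) \<le> (\<Sum>a\<in>totatives q. norm (cis (2 * pi / real q) ^ (a * n)))"
    unfolding ramanujan_sum_def by (rule norm_sum)
  also have "\<dots> = real (totient q)" by (simp add: norm_power totient_def)
  finally show ?thesis using totient_le[of q] by linarith
qed

text \<open>A chain d | q | k is determined by d and the cofactor m = q / d, which runs through the
  divisors of k / d.\<close>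

lemma sum_divisors_swap:
  fixes f :: "nat \<Rightarrow> nat \<Rightarrow> 'a::comm_monoid_add"
  assumes k: "k > 0"
  shows "(\<Sum>q | q dvd k. \<Sum>d | d dvd q. f q d) = (\<Sum>d | d dvd k. \<Sum>m | m dvd k div d. f (d * m) d)"
proof -
  have fin: "finite {d. d dvd q}" if "q dvd k" for q
    using that k by (intro finite_divisors_nat) (auto intro: dvd_pos_nat)
  have fin2: "finite {m. m dvd k div d}" if "d dvd k" for d
    using that k by (intro finite_divisors_nat) (auto simp: div_greater_zero_iff dvd_imp_le intro: dvd_pos_nat)
  have "(\<Sum>q | q dvd k. \<Sum>d | d dvd q. f q d) = (\<Sum>(q, d)\<in>Sigma {q. q dvd k} (\<lambda>q. {d. d dvd q}). f q d)"
    using fin k by (subst sum.Sigma) auto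
  also have "\<dots> = (\<Sum>(d, m)\<in>Sigma {d. d dvd k} (\<lambda>d. {m. m dvd k div d}). f (d * m) d)"
  proof (rule sum.reindex_bij_witness[of _ "\<lambda>(d, m). (d * m, d)" "\<lambda>(q, d). (d, q div d)"], goal_cases)
    case (1 a)
    then show ?case by auto
  next
    case (2 a)
    then show ?case using k by (auto elim!: dvdE)
  next
    case (3 b)
    then show ?case using k by (auto intro: Nat.gr0I)
  next
    case (4 b)
    then show ?case using k by (auto elim!: dvdE)
  next
    case (5 a)
    then show ?case by auto
  qed
  also have "\<dots> = (\<Sum>d | d dvd k. \<Sum>m | m dvd k div d. f (d * m) d)"
    using fin2 k by (subst sum.Sigma) auto
  finally show ?thesis .
qed

lemma sum_divisors_complement:
  assumes "k > (0::nat)"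
  shows "(\<Sum>d | d dvd k. f (k div d)) = (\<Sum>d | d dvd k. f d)"
  using assms by (intro sum.reindex_bij_witness[of _ "(div) k" "(div) k"]) (auto elim: dvdE)

text \<open>Moebius inversion of \<open>sum_ramanujan_sum_divisors\<close>: replace each term d,
  present when d divides n, by the sum of c_q(n) over q | d. After exchanging the sums, the inner
  Moebius sum leaves only q = r.\<close>

lemma ramanujan_sum_eq_moebius:
  assumes r: "r > 0"
  shows "ramanujan_sum r n = (\<Sum>d | d dvd r. if d dvd n then of_int (moebius (r div d)) * of_nat d else 0)"
proof -
  have "(\<Sum>d | d dvd r. if d dvd n then of_int (moebius (r div d)) * of_nat d else 0)
      = (\<Sum>d | d dvd r. \<Sum>q | q dvd d. of_int (moebius (r div d)) * ramanujan_sum q n)"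
  proof (rule sum.cong[OF refl], goal_cases)
    case (1 d)
    then have "d > 0" using r by (auto intro: dvd_pos_nat)
    from sum_ramanujan_sum_divisors[OF this, of n] show ?case
      by (simp flip: sum_distrib_left)
  qed
  also have "\<dots> = (\<Sum>q | q dvd r. \<Sum>m | m dvd r div q. of_int (moebius (r div (q * m))) * ramanujan_sum q n)"
    using r by (rule sum_divisors_swap)
  also have "\<dots> = (\<Sum>q | q dvd r. if q = r then ramanujan_sum r n else 0)"
  proof (rule sum.cong[OF refl], goal_cases)
    case (1 q)
    then obtain m where m: "r = q * m" by auto
    then have pos: "q > 0" "m > 0" using r by auto
    have "(\<Sum>m | m dvd r div q. moebius (r div (q * m))) = (\<Sum>d | d dvd m. moebius (m div d))"
      using pos by (simp add: m div_mult2_eq)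
    also have "\<dots> = (if m = 1 then 1 else 0)"
      using sum_divisors_complement[OF pos(2), of moebius] sum_moebius_divisors[OF pos(2)] by simp
    also have "\<dots> = (if q = r then 1 else 0)" using m pos by auto
    finally have *: "(\<Sum>m | m dvd r div q. complex_of_int (moebius (r div (q * m)))) = (if q = r then 1 else 0)"
      by (metis (mono_tags, lifting) of_int_0 of_int_1 of_int_sum sum.cong)
    show ?case using * by (simp flip: sum_distrib_right)
  qed
  also have "\<dots> = ramanujan_sum r n" using r by (simp add: sum.delta)
  finally show ?thesis ..
qed

section \<open>Counting the n up to N with d | n and e | n + h\<close>

lemma card_residue_class:
  fixes L c N :: nat
  assumes "1 \<le> c" "c \<le> L"
  shows "\<bar>real (card {n\<in>{1..N}. n mod L = c mod L}) - real N / real L\<bar> \<le> 1"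
proof -
  \<comment> \<open>\<open>q\<close> is the number of k with c + k * L at most N. Since c is at most
    L, the truncated subtraction is exact, and N < c gives \<open>q = 0\<close>.\<close>
  define q where "q = (N + L - c) div L"
  have L: "L > 0" using assms by simp
  have le_iff: "c + k * L \<le> N \<longleftrightarrow> k < q" for k
  proof -
    have "k < q \<longleftrightarrow> Suc k \<le> q" by auto
    also have "\<dots> \<longleftrightarrow> Suc k * L \<le> N + L - c"
      unfolding q_def using L by (rule less_eq_div_iff_mult_less_eq)
    also have "\<dots> \<longleftrightarrow> c + k * L \<le> N" using assms by auto
    finally show ?thesis by simp
  qed
  have "{n\<in>{1..N}. n mod L = c mod L} = (\<lambda>k. c + k * L) ` {..<q}"
  proof safe
    fix n assume n: "n \<in> {1..N}" "n mod L = c mod L"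
    have "c \<le> n"
    proof (rule ccontr)
      assume "\<not> c \<le> n"
      then have "n < L" "n mod L = n" using assms by auto
      then show False using n assms \<open>\<not> c \<le> n\<close> by (cases "c = L") auto
    qed
    then obtain k where "n = c + k * L"
      using n(2) by (metis mod_eq_nat1E mult.commute)
    then show "n \<in> (\<lambda>k. c + k * L) ` {..<q}" using n le_iff by auto
  next
    fix k assume "k < q"
    then show "c + k * L \<in> {1..N}" using assms le_iff by auto
  qed (auto)
  then have card: "card {n\<in>{1..N}. n mod L = c mod L} = q"
    using L by (simp add: card_image inj_on_def)
  have "q * L \<le> N + L - c" unfolding q_def by simp
  then have "q * L \<le> N + L" by simp
  then have "real q * real L \<le> real N + real L" by (metis of_nat_add of_nat_le_iff of_nat_mult)
  then have 1: "real q - real N / real L \<le> 1" using L by (simp add: field_simps)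
  have "N + L - c < q * L + L" unfolding q_def using L
    by (metis add.commute dividend_less_div_times)
  then have "N \<le> q * L + L" using assms by linarith
  then have "real N \<le> real q * real L + real L" by (metis of_nat_add of_nat_le_iff of_nat_mult)
  then have 2: "real N / real L - real q \<le> 1" using L by (simp add: field_simps)
  show ?thesis unfolding card using 1 2 by linarith
qed

definition pair_count :: "nat \<Rightarrow> nat \<Rightarrow> nat \<Rightarrow> nat \<Rightarrow> nat" where
  "pair_count h N d e = card {n\<in>{1..N}. d dvd n \<and> e dvd n + h}"

text \<open>In the solvable case this is 1 / lcm(d, e). Written with the gcd, its product with d * e
  is the value of a divisor sum of Ramanujan sums over gcd(d, e).\<close>

definition pair_density :: "nat \<Rightarrow> nat \<Rightarrow> nat \<Rightarrow> real" where
  "pair_density h d e = (if gcd d e dvd h then real (gcd d e) / (real d * real e) else 0)"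

lemma ex_common_solution:
  fixes d e h :: nat
  assumes "d > 0" "e > 0" "gcd d e dvd h"
  shows "\<exists>n. d dvd n \<and> e dvd n + h"
proof -
  obtain x y where xy: "d * x = e * y + gcd d e" using bezout_nat[of d e] assms by auto
  obtain k where k: "h = gcd d e * k" using assms by auto
  \<comment> \<open>Bezout yields d * x * k congruent to h modulo e, whereas -h is wanted. The
    factor \<open>e'\<close>, equal to e - 1, acts as -1 modulo e and avoids negative
    numbers.\<close>
  obtain e' where e': "e = Suc e'" using assms by (cases e) auto
  have "d * (x * k * e') + h = (d * x) * (k * e') + gcd d e * k"
    by (simp add: k algebra_simps)
  also have "\<dots> = e * (y * k * e') + gcd d e * k * Suc e'"
    unfolding xy by (simp add: algebra_simps)
  also have "\<dots> = e * (y * k * e' + gcd d e * k)"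
    unfolding e'[symmetric] by (simp add: algebra_simps)
  finally have "d * (x * k * e') + h = e * (y * k * e' + gcd d e * k)" .
  then show ?thesis by (intro exI[of _ "d * (x * k * e')"]) (metis dvd_triv_left)
qed

text \<open>If gcd(d, e) does not divide h, count and density both vanish. Otherwise the solutions
  form one residue class modulo lcm(d, e).\<close>

lemma abs_pair_count_minus_density_le:
  assumes d: "d > 0" and e: "e > 0"
  shows "\<bar>real (pair_count h N d e) - real N * pair_density h d e\<bar> \<le> 1"
proof (cases "gcd d e dvd h")
  case False
  have "{n\<in>{1..N}. d dvd n \<and> e dvd n + h} = {}"
  proof (rule equals0I, clarify)
    fix n assume "d dvd n" "e dvd n + h"
    then have "gcd d e dvd n" "gcd d e dvd n + h" by (meson gcd_dvd1 gcd_dvd2 dvd_trans)+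
    then show False using False dvd_add_right_iff by blast
  qed
  then have "pair_count h N d e = 0" unfolding pair_count_def by (simp only: card.empty)
  then show ?thesis using False by (simp add: pair_density_def)
next
  case True
  define L where "L = lcm d e"
  have L: "L > 0" using d e by (simp add: L_def lcm_pos_nat)
  obtain n0 where n0: "d dvd n0" "e dvd n0 + h" using ex_common_solution[OF d e True] by auto
  \<comment> \<open>\<open>card_residue_class\<close> expects a representative between 1 and L, so
    the residue 0 is represented by L.\<close>
  define c where "c = (if n0 mod L = 0 then L else n0 mod L)"
  have c: "1 \<le> c" "c \<le> L" "c mod L = n0 mod L"
    using L by (auto simp: c_def less_imp_le)
  \<comment> \<open>Subtracting the particular solution \<open>n0\<close> turns both conditions into
    divisibility of n - n0. This is done in the integers because n may be smaller than
    \<open>n0\<close>.\<close>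
  have "d dvd n \<and> e dvd n + h \<longleftrightarrow> n mod L = c mod L" for n
  proof -
    have "d dvd n \<longleftrightarrow> int d dvd int n - int n0"
      using n0 by (simp add: dvd_diff_left_iff)
    moreover have "e dvd n + h \<longleftrightarrow> int e dvd (int n + int h) - (int n0 + int h)"
      using n0 by (subst dvd_diff_left_iff) (simp_all flip: of_nat_add)
    ultimately have "d dvd n \<and> e dvd n + h \<longleftrightarrow> int L dvd int n - int n0"
      by (simp add: L_def flip: lcm_int_int_eq)
    also have "\<dots> \<longleftrightarrow> int n mod int L = int n0 mod int L"
      by (simp add: mod_eq_dvd_iff)
    also have "\<dots> \<longleftrightarrow> n mod L = c mod L"
      using c by (simp flip: zmod_int)
    finally show ?thesis .
  qed
  then have "pair_count h N d e = card {n\<in>{1..N}. n mod L = c mod L}"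
    by (simp add: pair_count_def)
  moreover have "pair_density h d e = 1 / real L"
  proof -
    have "real (gcd d e) * real L = real d * real e"
      unfolding L_def by (simp flip: of_nat_mult)
    then show ?thesis using True L d e by (simp add: pair_density_def field_simps)
  qed
  ultimately show ?thesis using card_residue_class[OF c(1,2), of N] by simp
qed

section \<open>The second moment of the divisor function and the total of the pair counts\<close>

lemma card_multiples_le:
  assumes "k > 0"
  shows "real (card {n\<in>{1..x}. k dvd n}) \<le> real x / real k"
proof -
  have "{n\<in>{1..x}. k dvd n} = (\<lambda>j. k * j) ` {1..x div k}"
    using assms by (auto elim!: dvdE simp: less_eq_div_iff_mult_less_eq Suc_le_eq mult.commute)
  then have "card {n\<in>{1..x}. k dvd n} = x div k"
    using assms by (simp add: card_image inj_on_def)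
  then show ?thesis by (simp add: of_nat_div_le_of_nat)
qed

text \<open>Encode a pair of divisors (d, e) by its gcd g and the quotients d / g and e / g. The
  encoding is injective, and the product of the three entries is lcm(d, e), which divides n.\<close>

lemma card_divisors_square_le:
  assumes "n \<in> {1..x}"
  shows "card {d::nat. d dvd n} ^ 2 \<le> card {(g, a, b). g \<in> {1..x} \<and> a \<in> {1..x} \<and> b \<in> {1..x} \<and> g * a * b dvd n}"
proof -
  let ?T = "{(g, a, b). g \<in> {1..x} \<and> a \<in> {1..x} \<and> b \<in> {1..x} \<and> g * a * b dvd n}"
  let ?j = "\<lambda>(d, e). (gcd d e, d div gcd d e, e div gcd d e)"
  let ?D = "{d. d dvd n}"
  have n: "n > 0" "n \<le> x" using assms by auto
  have "inj_on ?j (?D \<times> ?D)"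
    by (rule inj_on_inverseI[where g = "\<lambda>(g, a, b). (g * a, g * b)"]) auto
  moreover have "?j ` (?D \<times> ?D) \<subseteq> ?T"
  proof (clarsimp, intro conjI)
    fix d e assume de: "d dvd n" "e dvd n"
    then have pos: "d > 0" "e > 0" "d \<le> x" "e \<le> x"
      using n by (auto intro: dvd_pos_nat dest: dvd_imp_le)
    show "Suc 0 \<le> gcd d e" using pos by (simp add: Suc_le_eq)
    show "gcd d e \<le> x" using pos by (intro le_trans[OF gcd_le1_nat]) auto
    show "Suc 0 \<le> d div gcd d e" "Suc 0 \<le> e div gcd d e"
      using pos by (simp_all add: Suc_le_eq div_greater_zero_iff)
    show "d div gcd d e \<le> x" "e div gcd d e \<le> x" using pos by (meson div_le_dividend le_trans)+
    have "gcd d e * (d div gcd d e) * (e div gcd d e) = lcm d e"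
      by (simp add: lcm_nat_def div_mult_swap)
    also have "\<dots> dvd n" using de by simp
    finally show "d * (e div gcd d e) dvd n" by simp
  qed
  moreover have "finite ?T"
    by (rule finite_subset[of _ "{1..x} \<times> {1..x} \<times> {1..x}"]) auto
  ultimately have "card (?D \<times> ?D) \<le> card ?T" by (rule card_inj_on_le)
  then show ?thesis by (simp add: card_cartesian_product power2_eq_square)
qed

text \<open>After exchanging sums, each triple (g, a, b) has at most x / (g a b) multiples, and the
  sum of reciprocals factors into three harmonic sums. This is the source of the cube of the
  logarithm.\<close>

lemma sum_card_divisors_square_le:
  "(\<Sum>n=1..x. real (card {d::nat. d dvd n}) ^ 2) \<le> real x * (\<Sum>k=1..x. 1 / real k) ^ 3"
proof -
  let ?I = "{1..x} \<times> {1..x} \<times> {1..x}"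
  have "(\<Sum>n=1..x. real (card {d::nat. d dvd n}) ^ 2)
     \<le> (\<Sum>n=1..x. \<Sum>(g, a, b)\<in>?I. of_bool (g * a * b dvd n))"
  proof (rule sum_mono, goal_cases)
    case (1 n)
    have "{(g, a, b). g \<in> {1..x} \<and> a \<in> {1..x} \<and> b \<in> {1..x} \<and> g * a * b dvd n}
      = {t\<in>?I. case t of (g, a, b) \<Rightarrow> g * a * b dvd n}" by auto
    then have "card {d::nat. d dvd n} ^ 2 \<le> card {t\<in>?I. case t of (g, a, b) \<Rightarrow> g * a * b dvd n}"
      using card_divisors_square_le[OF 1] by simp
    also have "real \<dots> = (\<Sum>(g, a, b)\<in>?I. of_bool (g * a * b dvd n))"
      by (simp add: case_prod_unfold Int_def)
    finally show ?case by simp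
  qed
  also have "\<dots> = (\<Sum>t\<in>?I. \<Sum>n=1..x. case t of (g, a, b) \<Rightarrow> of_bool (g * a * b dvd n))"
    by (rule sum.swap)
  also have "\<dots> \<le> (\<Sum>t\<in>?I. case t of (g, a, b) \<Rightarrow> real x / real (g * a * b))"
  proof (rule sum_mono, clarify, goal_cases)
    case (1 g a b)
    have "(\<Sum>n=1..x. of_bool (g * a * b dvd n)) = real (card {n\<in>{1..x}. g * a * b dvd n})"
      by (simp add: Int_def)
    also have "\<dots> \<le> real x / real (g * a * b)" using 1 by (intro card_multiples_le) auto
    finally show ?case .
  qed
  also have "\<dots> = real x * (\<Sum>k=1..x. 1 / real k) ^ 3"
  proof -
    have "(\<Sum>t\<in>?I. case t of (g, a, b) \<Rightarrow> real x / real (g * a * b))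
        = (\<Sum>g=1..x. \<Sum>a=1..x. \<Sum>b=1..x. real x * (1 / real g * (1 / real a * (1 / real b))))"
      by (simp add: mult.assoc flip: sum.cartesian_product)
    also have "\<dots> = real x * ((\<Sum>k=1..x. 1 / real k) * ((\<Sum>k=1..x. 1 / real k) * (\<Sum>k=1..x. 1 / real k)))"
      by (simp only: sum_product) (simp only: sum_distrib_left)
    finally show ?thesis by (simp only: power3_eq_cube mult.assoc)
  qed
  finally show ?thesis .
qed

text \<open>The difference between the harmonic number of x and ln x decreases in x and equals 1 at
  x = 1.\<close>

lemma sum_inverse_le_ln:
  assumes "x > 0"
  shows "(\<Sum>k=1..x. 1 / real k) \<le> 1 + ln (real x)"
  using euler_mascheroni_sequence_decreasing[of 1 x] assms by (simp add: harm_def divide_inverse)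

text \<open>Bound each product by half the sum of the squares; both resulting sums are contained in
  the range up to N + h.\<close>

lemma sum_card_divisors_shift_le:
  fixes h N :: nat
  shows
  "(\<Sum>n=1..N. real (card {d. d dvd n} * card {d. d dvd n + h})) \<le> (\<Sum>n=1..N+h. real (card {d. d dvd n}) ^ 2)"
proof -
  let ?t = "\<lambda>n. real (card {d. d dvd n})"
  have "(\<Sum>n=1..N. real (card {d. d dvd n} * card {d. d dvd n + h})) \<le> (\<Sum>n=1..N. (?t n ^ 2 + ?t (n + h) ^ 2) / 2)"
  proof (rule sum_mono)
    show "real (card {d. d dvd n} * card {d. d dvd n + h}) \<le> (?t n ^ 2 + ?t (n + h) ^ 2) / 2" for n
      using sum_squares_bound[of "?t n" "?t (n + h)"] by simp
  qed
  also have "\<dots> = ((\<Sum>n=1..N. ?t n ^ 2) + (\<Sum>n=1..N. ?t (n + h) ^ 2)) / 2"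
    by (simp add: sum.distrib flip: sum_divide_distrib)
  also have "(\<Sum>n=1..N. ?t (n + h) ^ 2) = (\<Sum>n=1+h..N+h. ?t n ^ 2)"
    using sum.shift_bounds_cl_nat_ivl[of "\<lambda>n. ?t n ^ 2" 1 h N] by simp
  also have "\<dots> \<le> (\<Sum>n=1..N+h. ?t n ^ 2)" by (intro sum_mono2) auto
  also have "(\<Sum>n=1..N. ?t n ^ 2) \<le> (\<Sum>n=1..N+h. ?t n ^ 2)" by (intro sum_mono2) auto
  finally show ?thesis by simp
qed

text \<open>A summation range that does not depend on n allows divisor sums to be exchanged with a
  sum over n.\<close>

lemma sum_divisors_eq_sum_of_bool:
  fixes c :: "nat \<Rightarrow> 'a::semiring_1"
  assumes "0 < n" "n \<le> x"
  shows "(\<Sum>d | d dvd n. c d) = (\<Sum>d=1..x. of_bool (d dvd n) * c d)"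
proof -
  have eq: "{d. d dvd n} = {d\<in>{1..x}. d dvd n}"
  proof (intro equalityI subsetI)
    fix d assume d: "d \<in> {d. d dvd n}"
    have "d > 0" "d \<le> n" using d assms dvd_pos_nat[of n d] dvd_imp_le[of d n] by simp_all
    then show "d \<in> {d\<in>{1..x}. d dvd n}" using d assms by simp
  qed auto
  have "(\<Sum>d | d dvd n. c d) = (\<Sum>d=1..x. if d dvd n then c d else 0)"
    by (subst eq) (rule sum.inter_filter, simp)
  also have "\<dots> = (\<Sum>d=1..x. of_bool (d dvd n) * c d)" by (rule sum.cong) auto
  finally show ?thesis .
qed

lemma real_card_divisors:
  fixes n x :: nat
  assumes "0 < n" "n \<le> x"
  shows "real (card {d. d dvd n}) = (\<Sum>d=1..x. of_bool (d dvd n))"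
  using sum_divisors_eq_sum_of_bool[OF assms, of "\<lambda>_. 1 :: real"] by simp

lemma real_pair_count:
  "real (pair_count h N d e) = (\<Sum>n=1..N. of_bool (d dvd n) * of_bool (e dvd n + h))"
proof -
  have "{n\<in>{1..N}. d dvd n \<and> e dvd n + h} = {1..N} \<inter> {n. d dvd n \<and> e dvd n + h}" by auto
  then have "real (pair_count h N d e) = (\<Sum>n=1..N. of_bool (d dvd n \<and> e dvd n + h))"
    by (simp add: pair_count_def)
  then show ?thesis by (simp only: of_bool_conj)
qed

text \<open>Summing over n last turns the left side into the sum of \<tau>(n) \<tau>(n + h), where
  \<tau> counts divisors.\<close>

lemma sum_pair_count_le:
  assumes "N > 0"
  shows "(\<Sum>d=1..N. \<Sum>e=1..N+h. real (pair_count h N d e)) \<le> real (N + h) * (1 + ln (real (N + h))) ^ 3"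
proof -
  have "(\<Sum>d=1..N. \<Sum>e=1..N+h. real (pair_count h N d e))
      = (\<Sum>d=1..N. \<Sum>n=1..N. \<Sum>e=1..N+h. of_bool (d dvd n) * of_bool (e dvd n + h))"
    unfolding real_pair_count by (intro sum.cong refl sum.swap)
  also have "\<dots> = (\<Sum>n=1..N. \<Sum>d=1..N. \<Sum>e=1..N+h. of_bool (d dvd n) * of_bool (e dvd n + h))"
    by (rule sum.swap)
  also have "\<dots> = (\<Sum>n=1..N. real (card {d. d dvd n} * card {d. d dvd n + h}))"
  proof (rule sum.cong[OF refl], goal_cases)
    case (1 n)
    then have n: "n > 0" "n \<le> N" by auto
    show ?case
      unfolding of_nat_mult real_card_divisors[OF n] real_card_divisors[OF n(1)[THEN trans_less_add1] add_right_mono[OF n(2)]]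
      by (rule sum_product[symmetric])
  qed
  also have "\<dots> \<le> (\<Sum>n=1..N+h. real (card {d. d dvd n}) ^ 2)" by (rule sum_card_divisors_shift_le)
  also have "\<dots> \<le> real (N + h) * (\<Sum>k=1..N+h. 1 / real k) ^ 3" by (rule sum_card_divisors_square_le)
  also have "\<dots> \<le> real (N + h) * (1 + ln (real (N + h))) ^ 3"
    using assms by (intro mult_left_mono power_mono sum_inverse_le_ln sum_nonneg) auto
  finally show ?thesis .
qed

section \<open>Power sums with explicit constants, and unordered infinite sums\<close>

text \<open>Mean value theorem for x powr (-\<epsilon>) between m and m + 1.\<close>

lemma powr_telescope_bound:
  fixes m :: nat and \<epsilon> :: real
  assumes "\<epsilon> > 0" "m > 0"
  shows "real (Suc m) powr (- 1 - \<epsilon>) \<le> (real m powr (- \<epsilon>) - real (Suc m) powr (- \<epsilon>)) / \<epsilon>"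
proof -
  have "\<exists>z. real m < z \<and> z < real (Suc m) \<and>
      real (Suc m) powr (- \<epsilon>) - real m powr (- \<epsilon>) = (real (Suc m) - real m) * (- \<epsilon> * z powr (- \<epsilon> - 1))"
    using assms by (intro MVT2) (auto intro!: derivative_eq_intros)
  then obtain z where z: "real m < z" "z < real (Suc m)"
    "real (Suc m) powr (- \<epsilon>) - real m powr (- \<epsilon>) = - \<epsilon> * z powr (- \<epsilon> - 1)" by auto
  have "real (Suc m) powr (- \<epsilon> - 1) \<le> z powr (- \<epsilon> - 1)"
    using z assms by (intro powr_mono2') auto
  moreover have "(real m powr (- \<epsilon>) - real (Suc m) powr (- \<epsilon>)) / \<epsilon> = z powr (- \<epsilon> - 1)"
    using z(3) assms by (simp add: field_simps)
  moreover have "- 1 - \<epsilon> = - \<epsilon> - 1" by simp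
  ultimately show ?thesis by metis
qed

text \<open>The telescoping bound is summed from m = 2 on. The dependence on \<epsilon> is kept
  explicit because \<epsilon> will later shrink as N grows.\<close>

lemma sum_powr_le:
  assumes "\<epsilon> > 0"
  shows "(\<Sum>m=1..n. real m powr (- 1 - \<epsilon>)) \<le> 1 + 1 / \<epsilon>"
proof -
  have "(\<Sum>m=1..Suc n. real m powr (- 1 - \<epsilon>)) \<le> 1 + (1 - real (Suc n) powr (- \<epsilon>)) / \<epsilon>" for n
  proof (induction n)
    case (Suc n)
    have "(\<Sum>m=1..Suc (Suc n). real m powr (- 1 - \<epsilon>)) 
        \<le> 1 + (1 - real (Suc n) powr (- \<epsilon>)) / \<epsilon> + (real (Suc n) powr (- \<epsilon>) - real (Suc (Suc n)) powr (- \<epsilon>)) / \<epsilon>"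
      using Suc powr_telescope_bound[OF assms, of "Suc n"] by simp
    then show ?case by (simp add: diff_divide_distrib)
  qed simp
  moreover have "(1 - real (Suc n) powr (- \<epsilon>)) / \<epsilon> \<le> 1 / \<epsilon>" for n
    using assms by (simp add: divide_right_mono)
  ultimately have *: "(\<Sum>m=1..Suc n. real m powr (- 1 - \<epsilon>)) \<le> 1 + 1 / \<epsilon>" for n
    by (meson add_left_mono order_trans)
  show ?thesis using *[of "n - 1"] assms by (cases n) auto
qed

lemma
  assumes "\<epsilon> > (0::real)"
  shows summable_on_powr: "(\<lambda>m. real m powr (- 1 - \<epsilon>)) summable_on {0<..}"
    and infsum_powr_le: "(\<Sum>\<^sub>\<infinity>m\<in>{0<..}. real m powr (- 1 - \<epsilon>)) \<le> 1 + 1 / \<epsilon>"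
proof -
  have fin: "(\<Sum>m\<in>F. real m powr (- 1 - \<epsilon>)) \<le> 1 + 1 / \<epsilon>" if "finite F" "F \<subseteq> {0<..}" for F
  proof -
    have "(\<Sum>m\<in>F. real m powr (- 1 - \<epsilon>)) \<le> (\<Sum>m=1..Max (insert 0 F). real m powr (- 1 - \<epsilon>))"
      using that by (intro sum_mono2) (auto simp: Suc_le_eq)
    also have "\<dots> \<le> 1 + 1 / \<epsilon>" using assms by (rule sum_powr_le)
    finally show ?thesis .
  qed
  show "(\<lambda>m. real m powr (- 1 - \<epsilon>)) summable_on {0<..}"
    using fin by (intro nonneg_bdd_above_summable_on bdd_aboveI) auto
  then show "(\<Sum>\<^sub>\<infinity>m\<in>{0<..}. real m powr (- 1 - \<epsilon>)) \<le> 1 + 1 / \<epsilon>"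
    using fin by (rule infsum_le_finite_sums)
qed

lemma summable_on_norm_comparison:
  fixes f :: "'a \<Rightarrow> 'b::banach"
  assumes "g summable_on A" "\<And>x. x \<in> A \<Longrightarrow> norm (f x) \<le> g x"
  shows "f summable_on A"
  using Infinite_Sum.abs_summable_on_comparison_test'[OF assms] by (rule abs_summable_summable)

lemma has_sum_sum:
  fixes f :: "'i \<Rightarrow> 'a \<Rightarrow> 'b::topological_comm_monoid_add"
  assumes "finite I" "\<And>i. i \<in> I \<Longrightarrow> (f i has_sum s i) A"
  shows "((\<lambda>x. \<Sum>i\<in>I. f i x) has_sum (\<Sum>i\<in>I. s i)) A"
  using assms by (induction rule: finite_induct) (auto intro: has_sum_add)

lemma has_sum_Times_mult:
  fixes f :: "'a \<Rightarrow> 'c::real_normed_algebra" and g :: "'b \<Rightarrow> 'c"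
  assumes "(f has_sum S) A" "(g has_sum T) B" "(\<lambda>(x, y). f x * g y) summable_on A \<times> B"
  shows "((\<lambda>(x, y). f x * g y) has_sum S * T) (A \<times> B)"
  using assms(3)
  by (intro has_sum_SigmaI[where g = "\<lambda>x. f x * T"])
    (auto intro!: has_sum_cmult_right has_sum_cmult_left assms(1,2))

text \<open>For nonnegative terms, joint summability follows from the summability of the row sums
  \<open>f x * T\<close>.\<close>

lemma has_sum_Times_mult_nonneg:
  fixes f :: "'a \<Rightarrow> real" and g :: "'b \<Rightarrow> real"
  assumes "(f has_sum S) A" "(g has_sum T) B"
    and "\<And>x. x \<in> A \<Longrightarrow> f x \<ge> 0" "\<And>y. y \<in> B \<Longrightarrow> g y \<ge> 0"
  shows "((\<lambda>(x, y). f x * g y) has_sum S * T) (A \<times> B)"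
proof (rule has_sum_Times_mult[OF assms(1,2)])
  show "(\<lambda>(x, y). f x * g y) summable_on A \<times> B"
    by (rule summable_on_SigmaI[where g = "\<lambda>x. f x * T"])
      (use assms in \<open>auto intro!: has_sum_cmult_right summable_on_cmult_left intro: has_sum_imp_summable\<close>)
qed

lemma has_sum_greaterThan_0_imp_sums:
  fixes f :: "nat \<Rightarrow> 'a::{comm_monoid_add, t2_space}"
  assumes "(f has_sum S) {0<..}"
  shows "(\<lambda>k. f (Suc k)) sums S"
proof -
  have "{0<..} = range Suc" by (auto simp: image_iff gr0_conv_Suc)
  then have "((f \<circ> Suc) has_sum S) UNIV"
    using assms by (simp add: has_sum_reindex)
  then show ?thesis by (auto dest: has_sum_imp_sums simp: o_def)
qed

text \<open>Absolute convergence is what allows an ordered series to be read as an unordered sum,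
  which can then be rearranged freely.\<close>

lemma sums_imp_has_sum_greaterThan_0:
  fixes f :: "nat \<Rightarrow> 'a::banach"
  assumes "(\<lambda>k. f (Suc k)) sums S" "summable (\<lambda>k. norm (f (Suc k)))"
  shows "(f has_sum S) {0<..}"
proof -
  have "{0<..} = range Suc" by (auto simp: image_iff gr0_conv_Suc)
  moreover have "((f \<circ> Suc) has_sum S) UNIV"
    using norm_summable_imp_has_sum[OF assms(2,1)] by (simp add: o_def)
  ultimately show ?thesis by (simp add: has_sum_reindex)
qed

section \<open>The Moebius transform of one coefficient sequence\<close>

locale decaying_coefficients =
  fixes a :: "nat \<Rightarrow> complex" and K \<delta> :: real
  assumes delta_pos: "\<delta> > 0"
    and norm_le: "r > 0 \<Longrightarrow> norm (a r) \<le> K * real r powr (- 1 - \<delta>)"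
begin

text \<open>This is F(d) / d in the notation of the overview. Without the factor d it inherits the
  decay rate of the coefficients.\<close>

definition moebius_sum :: "nat \<Rightarrow> complex" where
  "moebius_sum d = (\<Sum>\<^sub>\<infinity>m\<in>{0<..}. of_int (moebius m) * a (d * m))"

lemma K_nonneg: "K \<ge> 0"
  using norm_le[of 1] norm_ge_zero[of "a 1"] by (simp del: norm_ge_zero)

lemma norm_moebius_term_le:
  assumes "d > 0" "m > 0"
  shows "norm (of_int (moebius m) * a (d * m)) \<le> K * real d powr (- 1 - \<delta>) * real m powr (- 1 - \<delta>)"
proof -
  have "norm (of_int (moebius m) * a (d * m)) = real_of_int \<bar>moebius m\<bar> * norm (a (d * m))"
    by (simp add: norm_mult)
  also have "\<dots> \<le> 1 * norm (a (d * m))"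
    using abs_moebius_le[of m] by (intro mult_right_mono norm_ge_zero) linarith
  also have "\<dots> \<le> K * real (d * m) powr (- 1 - \<delta>)" using norm_le[of "d * m"] assms by simp
  finally show ?thesis by (simp add: powr_mult)
qed

lemma has_sum_moebius_sum:
  assumes "d > 0"
  shows "((\<lambda>m. of_int (moebius m) * a (d * m)) has_sum moebius_sum d) {0<..}"
  unfolding moebius_sum_def
proof (rule has_sum_infsum, rule summable_on_norm_comparison)
  show "(\<lambda>m. K * real d powr (- 1 - \<delta>) * real m powr (- 1 - \<delta>)) summable_on {0<..}"
    by (intro summable_on_cmult_right summable_on_powr delta_pos)
qed (use norm_moebius_term_le[OF assms] in auto)

lemma norm_moebius_sum_le:
  assumes "d > 0"
  shows "norm (moebius_sum d) \<le> K * (1 + 1 / \<delta>) * real d powr (- 1 - \<delta>)"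
proof -
  have "norm (moebius_sum d) \<le> K * real d powr (- 1 - \<delta>) * (\<Sum>\<^sub>\<infinity>m\<in>{0<..}. real m powr (- 1 - \<delta>))"
  proof (rule norm_infsum_le[OF has_sum_moebius_sum[OF assms]])
    show "((\<lambda>m. K * real d powr (- 1 - \<delta>) * real m powr (- 1 - \<delta>)) has_sum
        K * real d powr (- 1 - \<delta>) * (\<Sum>\<^sub>\<infinity>m\<in>{0<..}. real m powr (- 1 - \<delta>))) {0<..}"
      by (intro has_sum_cmult_right has_sum_infsum summable_on_powr delta_pos)
  qed (use norm_moebius_term_le assms in auto)
  also have "\<dots> \<le> K * real d powr (- 1 - \<delta>) * (1 + 1 / \<delta>)"
    by (intro mult_left_mono infsum_powr_le delta_pos mult_nonneg_nonneg K_nonneg) auto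
  finally show ?thesis by (simp add: mult_ac)
qed

text \<open>Insert the Moebius formula for c_r(n). Only the finitely many d dividing n occur, so a
  finite sum is exchanged with an infinite one; for fixed d, the substitution r = d * m produces
  \<open>moebius_sum d\<close>.\<close>

lemma expansion_eq_divisor_sum:
  assumes "has_abs_convergent_ramanujan_expansion f a" "n > 0"
  shows "f n = (\<Sum>d | d dvd n. of_nat d * moebius_sum d)"
proof -
  have "(\<lambda>k. a (Suc k) * ramanujan_sum (Suc k) n) sums f n"
    "summable (\<lambda>k. norm (a (Suc k) * ramanujan_sum (Suc k) n))"
    using assms by (auto simp: has_abs_convergent_ramanujan_expansion_def has_ramanujan_expansion_def)
  then have 1: "((\<lambda>r. a r * ramanujan_sum r n) has_sum f n) {0<..}"
    by (rule sums_imp_has_sum_greaterThan_0)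
  have "((\<lambda>r. if d dvd r then a r * (of_int (moebius (r div d)) * of_nat d) else 0)
      has_sum of_nat d * moebius_sum d) {0<..}" if "d dvd n" for d
  proof -
    have d: "d > 0" using that assms by (auto intro: dvd_pos_nat)
    have "((\<lambda>m. of_nat d * (of_int (moebius m) * a (d * m))) has_sum of_nat d * moebius_sum d) {0<..}"
      by (intro has_sum_cmult_right has_sum_moebius_sum d)
    also have "?this \<longleftrightarrow> ((\<lambda>r. a r * (of_int (moebius (r div d)) * of_nat d)) has_sum of_nat d * moebius_sum d)
        {r\<in>{0<..}. d dvd r}"
      by (rule has_sum_reindex_bij_witness[of _ "\<lambda>r. r div d" "\<lambda>m. d * m"])
        (use d in \<open>auto simp: div_greater_zero_iff dvd_imp_le\<close>)
    also have "\<dots> \<longleftrightarrow> ?thesis"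
      by (rule has_sum_cong_neutral) auto
    finally show ?thesis .
  qed
  then have 2: "((\<lambda>r. \<Sum>d | d dvd n. if d dvd r then a r * (of_int (moebius (r div d)) * of_nat d) else 0)
      has_sum (\<Sum>d | d dvd n. of_nat d * moebius_sum d)) {0<..}"
    using assms by (intro has_sum_sum) auto
  have "((\<lambda>r. a r * ramanujan_sum r n) has_sum (\<Sum>d | d dvd n. of_nat d * moebius_sum d)) {0<..}"
  proof (rule has_sum_cong[THEN iffD1, OF _ 2])
    fix r :: nat assume "r \<in> {0<..}"
    then have r: "r > 0" by simp
    have "(\<Sum>d | d dvd n. if d dvd r then a r * (of_int (moebius (r div d)) * of_nat d) else 0)
        = (\<Sum>d\<in>{d. d dvd n} \<inter> {d. d dvd r}. a r * (of_int (moebius (r div d)) * of_nat d))"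
      using assms by (simp add: sum.If_cases)
    also have "\<dots> = (\<Sum>d\<in>{d. d dvd r} \<inter> {d. d dvd n}. a r * (of_int (moebius (r div d)) * of_nat d))"
      by (simp add: Int_commute)
    also have "\<dots> = a r * ramanujan_sum r n"
      using r by (simp add: ramanujan_sum_eq_moebius sum.If_cases sum_distrib_left)
    finally show "(\<Sum>d | d dvd n. if d dvd r then a r * (of_int (moebius (r div d)) * of_nat d) else 0)
        = a r * ramanujan_sum r n" .
  qed
  with 1 show ?thesis by (rule has_sum_unique)
qed

text \<open>Moebius inversion for infinite sums. The double family over (t, m) is absolutely
  summable and is summed in two ways.\<close>

lemma has_sum_moebius_sum_multiples:
  assumes q: "q > 0"
  shows "((\<lambda>t. moebius_sum (q * t)) has_sum a q) {0<..}"
proof -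
  let ?P = "{0<..} :: nat set"
  let ?X = "\<lambda>(t, m). of_int (moebius m) * a (q * t * m)"
  let ?Y = "\<lambda>(k, m). of_int (moebius m) * a (q * k)"
  have sum: "?X summable_on ?P \<times> ?P"
  proof (rule summable_on_norm_comparison)
    show "(\<lambda>(t, m). K * real q powr (- 1 - \<delta>) * real t powr (- 1 - \<delta>) * real m powr (- 1 - \<delta>)) summable_on ?P \<times> ?P"
      using summable_on_powr[OF delta_pos, THEN has_sum_infsum] 
      by (intro has_sum_imp_summable[OF has_sum_Times_mult_nonneg[OF has_sum_cmult_right]]
          mult_nonneg_nonneg K_nonneg) auto
    fix x :: "nat \<times> nat" assume "x \<in> ?P \<times> ?P"
    then obtain t m where "x = (t, m)" "t > 0" "m > 0" by auto
    then show "norm (?X x) \<le> (case x of (t, m) \<Rightarrow> K * real q powr (- 1 - \<delta>) * real t powr (- 1 - \<delta>) * real m powr (- 1 - \<delta>))"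
      using norm_moebius_term_le[of "q * t" m] q by (simp add: powr_mult mult_ac)
  qed
  define S where "S = infsum ?X (?P \<times> ?P)"
  have S: "(?X has_sum S) (?P \<times> ?P)" unfolding S_def using sum by (rule has_sum_infsum)
  have 1: "((\<lambda>t. moebius_sum (q * t)) has_sum S) ?P"
    by (rule has_sum_SigmaD[OF S]) (use has_sum_moebius_sum q in auto)
  \<comment> \<open>Now group by the product k = t * m: the inner sum of \<open>moebius m\<close>
    over m | k vanishes unless k = 1.\<close>
  have "(?X has_sum S) (?P \<times> ?P) \<longleftrightarrow> (?Y has_sum S) (Sigma ?P (\<lambda>k. {m. m dvd k}))"
    by (rule has_sum_reindex_bij_witness[of _ "\<lambda>(k, m). (k div m, m)" "\<lambda>(t, m). (t * m, m)"])
      (auto simp: mult.assoc div_greater_zero_iff dvd_imp_le intro: dvd_pos_nat)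
  then have Y: "(?Y has_sum S) (Sigma ?P (\<lambda>k. {m. m dvd k}))" using S by simp
  have "((\<lambda>k. if k = 1 then a (q * k) else 0) has_sum S) ?P"
  proof (rule has_sum_SigmaD[OF Y])
    fix k assume "k \<in> ?P"
    then have k: "k > 0" by simp
    have "(\<Sum>m | m dvd k. complex_of_int (moebius m)) = (if k = 1 then 1 else 0)"
      using sum_moebius_divisors[OF k] by (metis (mono_tags, lifting) of_int_0 of_int_1 of_int_sum sum.cong)
    then have "(\<Sum>m | m dvd k. ?Y (k, m)) = (if k = 1 then a (q * k) else 0)"
      by (simp flip: sum_distrib_right)
    then show "((\<lambda>m. ?Y (k, m)) has_sum (if k = 1 then a (q * k) else 0)) {m. m dvd k}"
      using k has_sum_finite[of "{m. m dvd k}" "\<lambda>m. ?Y (k, m)"] by simp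
  qed
  moreover have "((\<lambda>k. if k = 1 then a (q * k) else 0) has_sum a q) ?P"
    by (rule has_sum_finite_neutralI[of "{1}"]) auto
  ultimately have "S = a q" by (rule has_sum_unique)
  with 1 show ?thesis by simp
qed

end

section \<open>The main term and the shifted convolution as sums over pairs (d, e)\<close>

locale coefficient_pair =
  A: decaying_coefficients a K \<delta> + B: decaying_coefficients b L \<delta>
  for a b :: "nat \<Rightarrow> complex" and K L \<delta> :: real +
  fixes h :: nat
begin

abbreviation \<alpha> where "\<alpha> \<equiv> A.moebius_sum"
abbreviation \<beta> where "\<beta> \<equiv> B.moebius_sum"

lemmas has_sum_powr = summable_on_powr[OF A.delta_pos, THEN has_sum_infsum]

abbreviation "M \<equiv> K * (1 + 1 / \<delta>) * (L * (1 + 1 / \<delta>))"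

lemma M_nonneg: "M \<ge> 0"
  using A.K_nonneg B.K_nonneg A.delta_pos by simp

lemma norm_mult_moebius_sums_le:
  assumes "d > 0" "e > 0"
  shows "norm (\<alpha> d * \<beta> e) \<le> M * (real d powr (- 1 - \<delta>) * real e powr (- 1 - \<delta>))"
proof -
  have "norm (\<alpha> d * \<beta> e) \<le> (K * (1 + 1 / \<delta>) * real d powr (- 1 - \<delta>)) * (L * (1 + 1 / \<delta>) * real e powr (- 1 - \<delta>))"
    unfolding norm_mult using assms A.K_nonneg A.delta_pos
    by (intro mult_mono A.norm_moebius_sum_le B.norm_moebius_sum_le) auto
  then show ?thesis by (simp only: mult_ac)
qed

text \<open>This justifies passing between the series over q and the series over pairs (d, e) = (q *
  t, q * s). The majorant is a product of three convergent power sums.\<close>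

lemma summable_triple:
  "(\<lambda>(q, t, s). ramanujan_sum q h * (\<alpha> (q * t) * \<beta> (q * s))) summable_on {0<..} \<times> {0<..} \<times> {0<..}"
proof (rule summable_on_norm_comparison)
  let ?Z = "\<lambda>m::nat. real m powr (- 1 - \<delta>)"
  have "((\<lambda>(t, s). ?Z t * ?Z s) has_sum infsum ?Z {0<..} * infsum ?Z {0<..}) ({0<..} \<times> {0<..})"
    by (rule has_sum_Times_mult_nonneg[OF has_sum_powr has_sum_powr]) auto
  note has_sum_Times_mult_nonneg[OF has_sum_cmult_right[OF has_sum_powr, of M] this]
  then have "((\<lambda>(q, ts). M * ?Z q * (case ts of (t, s) \<Rightarrow> ?Z t * ?Z s)) has_sum
      M * infsum ?Z {0<..} * (infsum ?Z {0<..} * infsum ?Z {0<..})) ({0<..} \<times> {0<..} \<times> {0<..})"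
    using M_nonneg by (auto split: prod.splits)
  then show "(\<lambda>(q, ts). M * ?Z q * (case ts of (t, s) \<Rightarrow> ?Z t * ?Z s)) summable_on ({0<..} \<times> {0<..} \<times> {0<..})"
    by (rule has_sum_imp_summable)
  fix x :: "nat \<times> nat \<times> nat" assume "x \<in> {0<..} \<times> {0<..} \<times> {0<..}"
  then obtain q t s where x: "x = (q, t, s)" and pos: "q > 0" "t > 0" "s > 0" by auto
  have "norm (ramanujan_sum q h * (\<alpha> (q * t) * \<beta> (q * s))) \<le> real q * (M * (?Z (q * t) * ?Z (q * s)))"
    unfolding norm_mult[of "ramanujan_sum q h"]
    using pos by (intro mult_mono norm_ramanujan_sum_le norm_mult_moebius_sums_le) auto
  also have "\<dots> = M * (real q * ?Z q) * ?Z q * (?Z t * ?Z s)"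
    by (simp add: powr_mult mult_ac)
  \<comment> \<open>One of the two factors q powr (-1-\<delta>) absorbs the trivial bound q for the
    Ramanujan sum; the other makes the sum over q converge.\<close>
  also have "\<dots> \<le> M * 1 * ?Z q * (?Z t * ?Z s)"
  proof (intro mult_right_mono mult_left_mono M_nonneg)
    have "real q * ?Z q = real q powr (- \<delta>)"
      using pos powr_add[of "real q" 1 "- 1 - \<delta>"] by simp
    also have "\<dots> \<le> real q powr 0" using pos A.delta_pos by (intro powr_mono) auto
    finally show "real q * ?Z q \<le> 1" using pos by simp
  qed auto
  finally show "norm (case x of (q, t, s) \<Rightarrow> ramanujan_sum q h * (\<alpha> (q * t) * \<beta> (q * s)))
      \<le> (case x of (q, ts) \<Rightarrow> M * ?Z q * (case ts of (t, s) \<Rightarrow> ?Z t * ?Z s))"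
    unfolding x by simp
qed

text \<open>Taking the triple sum as the definition lets both evaluations below compute the same
  number.\<close>

definition main_term :: complex where
  "main_term = infsum (\<lambda>(q, t, s). ramanujan_sum q h * (\<alpha> (q * t) * \<beta> (q * s))) ({0<..} \<times> {0<..} \<times> {0<..})"

lemma has_sum_triple:
  "((\<lambda>(q, t, s). ramanujan_sum q h * (\<alpha> (q * t) * \<beta> (q * s))) has_sum main_term) ({0<..} \<times> {0<..} \<times> {0<..})"
  unfolding main_term_def by (rule has_sum_infsum[OF summable_triple])

text \<open>For fixed q the sums over t and s separate, and each one is a Moebius inversion giving
  back a coefficient.\<close>

lemma has_sum_main_term: "((\<lambda>q. a q * b q * ramanujan_sum q h) has_sum main_term) {0<..}"
proof (rule has_sum_SigmaD[OF has_sum_triple])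
  fix q :: nat assume "q \<in> {0<..}"
  then have q: "q > 0" by simp
  define f where "f = (\<lambda>(t, s). ramanujan_sum q h * (\<alpha> (q * t) * \<beta> (q * s)))"
  have "f summable_on {0<..} \<times> {0<..}"
    unfolding f_def by (rule summable_on_SigmaD1[OF summable_triple]) (use q in simp)
  then have "(\<lambda>(t, s). (ramanujan_sum q h * \<alpha> (q * t)) * \<beta> (q * s)) summable_on {0<..} \<times> {0<..}"
    by (simp add: f_def mult.assoc)
  from has_sum_Times_mult[OF has_sum_cmult_right[OF A.has_sum_moebius_sum_multiples[OF q]]
      B.has_sum_moebius_sum_multiples[OF q] this]
  show "((\<lambda>y. case (q, y) of (q, t, s) \<Rightarrow> ramanujan_sum q h * (\<alpha> (q * t) * \<beta> (q * s))) has_sum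
      a q * b q * ramanujan_sum q h) ({0<..} \<times> {0<..})"
    by (simp add: mult_ac)
qed

text \<open>For fixed d = q * t and e = q * s, the index q runs through the common divisors. The sum
  of c_q(h) over them is gcd(d, e) if this divides h and 0 otherwise.\<close>

lemma has_sum_main_term_pairs:
  "((\<lambda>(d, e). \<alpha> d * \<beta> e * of_real (real d * real e * pair_density h d e)) has_sum main_term) ({0<..} \<times> {0<..})"
proof -
  let ?P = "{0<..} :: nat set"
  let ?Y = "\<lambda>((d, e), q). ramanujan_sum q h * (\<alpha> d * \<beta> e)"
  let ?T = "Sigma (?P \<times> ?P) (\<lambda>(d, e). {q. q dvd gcd d e})"
  have "((\<lambda>(q, t, s). ramanujan_sum q h * (\<alpha> (q * t) * \<beta> (q * s))) has_sum main_term) (?P \<times> ?P \<times> ?P)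
      \<longleftrightarrow> (?Y has_sum main_term) ?T"
  proof (rule has_sum_reindex_bij_witness[of _ "\<lambda>((d, e), q). (q, d div q, e div q)" "\<lambda>(q, t, s). ((q * t, q * s), q)"], goal_cases)
    case (4 x)
    then obtain d e q where x: "x = ((d, e), q)" "d > 0" "e > 0" "q dvd d" "q dvd e" by auto
    moreover from this have "q > 0" by (auto intro: dvd_pos_nat)
    ultimately show ?case by (auto simp: div_greater_zero_iff dvd_imp_le)
  qed auto
  with has_sum_triple have "(?Y has_sum main_term) ?T" by simp
  then show ?thesis
  proof (rule has_sum_SigmaD)
    fix x assume "x \<in> ?P \<times> ?P"
    then obtain d e where x: "x = (d, e)" and pos: "d > 0" "e > 0" by auto
    let ?g = "gcd d e"
    have g: "?g > 0" using pos by simp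
    have "(\<Sum>q | q dvd ?g. ?Y (x, q)) = \<alpha> d * \<beta> e * of_real (real d * real e * pair_density h d e)"
      using sum_ramanujan_sum_divisors[OF g, of h] pos
      by (simp add: x pair_density_def del: gcd_greatest_iff flip: sum_distrib_right)
    then show "((\<lambda>q. ?Y (x, q)) has_sum
        (case x of (d, e) \<Rightarrow> \<alpha> d * \<beta> e * of_real (real d * real e * pair_density h d e)))
        (case x of (d, e) \<Rightarrow> {q. q dvd gcd d e})"
      using has_sum_finite[OF finite_divisors_nat[OF g], of "\<lambda>q. ?Y (x, q)"] by (simp add: x)
  qed
qed

text \<open>Expand both factors into divisor sums and sum over n innermost. The family has finite
  support, as \<open>pair_count\<close> vanishes unless d is at most N and e at most N + h.\<close>

lemma has_sum_shifted_convolution: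
  assumes f: "has_abs_convergent_ramanujan_expansion f a"
    and g: "has_abs_convergent_ramanujan_expansion g b"
  shows "((\<lambda>(d, e). \<alpha> d * \<beta> e * of_real (real d * real e * real (pair_count h N d e))) has_sum
    (\<Sum>n=1..N. f n * g (n + h))) ({0<..} \<times> {0<..})"
proof (rule has_sum_finite_neutralI[of "{1..N} \<times> {1..N+h}"])
  show "finite ({1..N} \<times> {1..N+h})" by simp
  show "{1..N} \<times> {1..N+h} \<subseteq> {0<..} \<times> {0<..}" by auto
  fix x assume x: "x \<in> {0<..} \<times> {0<..} - {1..N} \<times> {1..N+h}"
  obtain d e where de: "x = (d, e)" by fastforce
  have "pair_count h N d e = 0"
    using x by (auto simp: de pair_count_def dest!: dvd_imp_le)
  then show "(case x of (d, e) \<Rightarrow> \<alpha> d * \<beta> e * of_real (real d * real e * real (pair_count h N d e))) = 0"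
    by (simp add: de)
next
  have "(\<Sum>n=1..N. f n * g (n + h)) = (\<Sum>n=1..N. \<Sum>d=1..N. \<Sum>e=1..N+h.
      (of_bool (d dvd n) * (of_nat d * \<alpha> d)) * (of_bool (e dvd n + h) * (of_nat e * \<beta> e)))"
  proof (rule sum.cong[OF refl], goal_cases)
    case (1 n)
    then have n: "0 < n" "n \<le> N" "0 < n + h" "n + h \<le> N + h" by auto
    show ?case
      unfolding A.expansion_eq_divisor_sum[OF f n(1)] B.expansion_eq_divisor_sum[OF g n(3)]
        sum_divisors_eq_sum_of_bool[OF n(1,2)] sum_divisors_eq_sum_of_bool[OF n(3,4)] by (rule sum_product)
  qed
  also have "\<dots> = (\<Sum>d=1..N. \<Sum>n=1..N. \<Sum>e=1..N+h.
      (of_bool (d dvd n) * (of_nat d * \<alpha> d)) * (of_bool (e dvd n + h) * (of_nat e * \<beta> e)))"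
    by (rule sum.swap)
  also have "\<dots> = (\<Sum>d=1..N. \<Sum>e=1..N+h. \<Sum>n=1..N.
      (of_bool (d dvd n) * (of_nat d * \<alpha> d)) * (of_bool (e dvd n + h) * (of_nat e * \<beta> e)))"
    by (rule sum.cong[OF refl]) (rule sum.swap)
  also have "\<dots> = (\<Sum>d=1..N. \<Sum>e=1..N+h. \<alpha> d * \<beta> e * of_real (real d * real e * real (pair_count h N d e)))"
  proof (intro sum.cong refl, goal_cases)
    case (1 d e)
    have "complex_of_real (real (pair_count h N d e)) = (\<Sum>n=1..N. of_bool (d dvd n) * of_bool (e dvd n + h))"
      unfolding real_pair_count by simp
    then show ?case
      unfolding of_real_mult sum_distrib_left
      by (simp only: sum_distrib_left of_real_of_nat_eq) (rule sum.cong, simp_all only: mult_ac)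
  qed
  finally show "(\<Sum>n=1..N. f n * g (n + h)) = (\<Sum>x\<in>{1..N} \<times> {1..N+h}.
      case x of (d, e) \<Rightarrow> \<alpha> d * \<beta> e * of_real (real d * real e * real (pair_count h N d e)))"
    by (simp add: sum.cartesian_product)
qed

section \<open>Estimating the error\<close>

definition count_error :: "nat \<Rightarrow> nat \<Rightarrow> nat \<Rightarrow> real" where
  "count_error N d e = \<bar>real (pair_count h N d e) - real N * pair_density h d e\<bar>"

lemma sums_main_term: "(\<lambda>k. a (Suc k) * b (Suc k) * ramanujan_sum (Suc k) h) sums main_term"
  using has_sum_greaterThan_0_imp_sums[OF has_sum_main_term] .

text \<open>The two expansions over pairs differ only in the count versus its expected value. The
  weight d * e and the decay of \<alpha> and \<beta> combine to (d e) powr (-\<delta>). The majorant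
  \<open>w\<close> stays free, so that each range of \<delta> can supply its own.\<close>

lemma norm_error_le:
  assumes f: "has_abs_convergent_ramanujan_expansion f a"
    and g: "has_abs_convergent_ramanujan_expansion g b"
    and bound: "\<And>d e. d > 0 \<Longrightarrow> e > 0 \<Longrightarrow> (real d * real e) powr (- \<delta>) * count_error N d e \<le> w (d, e)"
    and w: "(w has_sum W) ({0<..} \<times> {0<..})"
  shows "norm (shifted_convolution_error f a g b h N) \<le> M * W"
proof -
  let ?u = "\<lambda>(d, e). \<alpha> d * \<beta> e * of_real (real d * real e * real (pair_count h N d e))
    + (- of_nat N) * (\<alpha> d * \<beta> e * of_real (real d * real e * pair_density h d e))"
  have "shifted_convolution_error f a g b h N = (\<Sum>n=1..N. f n * g (n + h)) + (- of_nat N) * main_term"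
    unfolding shifted_convolution_error_def using sums_unique[OF sums_main_term] by simp
  moreover have "(?u has_sum (\<Sum>n=1..N. f n * g (n + h)) + (- of_nat N) * main_term) ({0<..} \<times> {0<..})"
    using has_sum_add[OF has_sum_shifted_convolution[OF f g, of N] has_sum_cmult_right[OF has_sum_main_term_pairs, of "- of_nat N"]]
    by (simp add: case_prod_unfold)
  moreover have "norm (?u x) \<le> M * w x" if "x \<in> {0<..} \<times> {0<..}" for x
  proof -
    obtain d e where x: "x = (d, e)" by (cases x)
    then have pos: "d > 0" "e > 0" using that by auto
    have "?u x = (\<alpha> d * \<beta> e) * of_real (real d * real e * (real (pair_count h N d e) - real N * pair_density h d e))"
      by (simp add: x algebra_simps)
    then have "norm (?u x) = norm (\<alpha> d * \<beta> e) * (real d * real e * count_error N d e)"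
      by (simp only: norm_mult norm_of_real count_error_def abs_mult abs_of_nat)
    also have "\<dots> \<le> M * (real d powr (- 1 - \<delta>) * real e powr (- 1 - \<delta>)) * (real d * real e * count_error N d e)"
      using pos by (intro mult_right_mono norm_mult_moebius_sums_le) (auto simp: count_error_def)
    also have "\<dots> = M * ((real d powr (- 1 - \<delta>) * real d) * (real e powr (- 1 - \<delta>) * real e) * count_error N d e)"
      by (simp only: mult_ac)
    also have "\<dots> = M * ((real d * real e) powr (- \<delta>) * count_error N d e)"
      using pos powr_add[of "real d" "- 1 - \<delta>" 1] powr_add[of "real e" "- 1 - \<delta>" 1]
      by (simp add: powr_mult)
    also have "\<dots> \<le> M * w x" unfolding x using pos by (intro mult_left_mono bound M_nonneg)
    finally show ?thesis .
  qed
  ultimately show ?thesis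
    using norm_infsum_le[OF _ has_sum_cmult_right[OF w], of ?u] by simp
qed

lemma pair_density_le:
  assumes "h > 0" "d > 0" "e > 0"
  shows "pair_density h d e \<le> real h / (real d * real e)"
  using assms by (auto simp: pair_density_def intro!: divide_right_mono dest: dvd_imp_le)

lemma norm_error_le_of_gt_1:
  assumes "has_abs_convergent_ramanujan_expansion f a"
    and "has_abs_convergent_ramanujan_expansion g b"
    and "\<delta> > 1"
  shows "norm (shifted_convolution_error f a g b h N) \<le> M * (1 + 1 / (\<delta> - 1))\<^sup>2"
proof -
  \<comment> \<open>The exponent is -\<delta>, written in the shape that
    \<open>summable_on_powr\<close> expects.\<close>
  let ?w = "\<lambda>d::nat. real d powr (- 1 - (\<delta> - 1))"
  have w: "(?w has_sum infsum ?w {0<..}) {0<..}"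
    using assms by (intro has_sum_infsum summable_on_powr) simp
  have "norm (shifted_convolution_error f a g b h N) \<le> M * (infsum ?w {0<..} * infsum ?w {0<..})"
  proof (rule norm_error_le[OF assms(1,2) _ has_sum_Times_mult_nonneg[OF w w]])
    fix d e :: nat assume "d > 0" "e > 0"
    then have "(real d * real e) powr - \<delta> * count_error N d e \<le> (real d * real e) powr - \<delta> * 1"
      unfolding count_error_def by (intro mult_left_mono abs_pair_count_minus_density_le) auto
    then show "(real d * real e) powr - \<delta> * count_error N d e \<le> (case (d, e) of (d, e) \<Rightarrow> ?w d * ?w e)"
      by (simp add: powr_mult)
  qed auto
  also have "\<dots> \<le> M * ((1 + 1 / (\<delta> - 1)) * (1 + 1 / (\<delta> - 1)))"
    using assms by (intro mult_left_mono mult_mono infsum_powr_le M_nonneg infsum_nonneg) auto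
  finally show ?thesis by (simp add: power2_eq_square)
qed

text \<open>
  The cutoff \<open>U\<close> separates the pairs \<open>(d, e)\<close> with \<open>d * e \<le> U\<close>, where the counting error is bounded
  by \<open>1\<close>, from the others, where the count and its expected value are estimated separately.
\<close>
lemma weighted_count_error_le:
  assumes U: "U \<ge> 1" and \<epsilon>: "0 < \<epsilon>" "\<epsilon> \<le> \<delta>" and "\<delta> \<le> 1" "h > 0" "d > 0" "e > 0"
  shows "(real d * real e) powr (- \<delta>) * count_error N d e \<le>
    (U powr (1 - \<delta> + \<epsilon>) + real h * real N * U powr (\<epsilon> - \<delta>)) * (real d powr (- 1 - \<epsilon>) * real e powr (- 1 - \<epsilon>))
     + U powr (- \<delta>) * real (pair_count h N d e)"
proof -
  define x where "x = real d * real e"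
  have x: "x > 0" using assms by (simp add: x_def)
  have xp: "x powr (- 1 - \<epsilon>) = real d powr (- 1 - \<epsilon>) * real e powr (- 1 - \<epsilon>)"
    by (simp add: x_def powr_mult)
  have "x powr (- \<delta>) * count_error N d e \<le>
    (U powr (1 - \<delta> + \<epsilon>) + real h * real N * U powr (\<epsilon> - \<delta>)) * x powr (- 1 - \<epsilon>)
     + U powr (- \<delta>) * real (pair_count h N d e)"
  proof (cases "x \<le> U")
    case True
    have "x powr (- \<delta>) * count_error N d e \<le> x powr (- \<delta>) * 1"
      unfolding count_error_def using assms by (intro mult_left_mono abs_pair_count_minus_density_le) auto
    \<comment> \<open>For small x the exponent 1 - \<delta> + \<epsilon> is nonnegative, so x may be
      raised to U; a summable power of x remains.\<close>
    also have "\<dots> = x powr (1 - \<delta> + \<epsilon>) * x powr (- 1 - \<epsilon>)" by (simp flip: powr_add)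
    also have "\<dots> \<le> U powr (1 - \<delta> + \<epsilon>) * x powr (- 1 - \<epsilon>)"
      using True x assms by (intro mult_right_mono powr_mono2) auto
    finally have "x powr (- \<delta>) * count_error N d e \<le> U powr (1 - \<delta> + \<epsilon>) * x powr (- 1 - \<epsilon>)" .
    moreover have "0 \<le> real h * real N * U powr (\<epsilon> - \<delta>) * x powr (- 1 - \<epsilon>)" by simp
    moreover have "0 \<le> U powr (- \<delta>) * real (pair_count h N d e)" by simp
    ultimately show ?thesis unfolding distrib_right by linarith
  next
    case False
    then have xU: "U \<le> x" by simp
    have "count_error N d e \<le> real (pair_count h N d e) + real N * (real h / x)"
    proof -
      have "real N * pair_density h d e \<le> real N * (real h / x)"
        unfolding x_def using assms by (intro mult_left_mono pair_density_le) auto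
      moreover have "0 \<le> real N * pair_density h d e" by (simp add: pair_density_def)
      ultimately show ?thesis unfolding count_error_def by linarith
    qed
    then have "x powr (- \<delta>) * count_error N d e
        \<le> x powr (- \<delta>) * (real (pair_count h N d e) + real N * (real h / x))"
      by (intro mult_left_mono) auto
    also have "\<dots> = x powr (- \<delta>) * real (pair_count h N d e) + real h * real N * (x powr (- \<delta>) / x)"
      by (simp add: algebra_simps)
    also have "x powr (- \<delta>) / x = x powr (\<epsilon> - \<delta>) * x powr (- 1 - \<epsilon>)"
      using x powr_minus_divide[of x 1] by (simp flip: powr_add add: powr_diff powr_minus_divide)
    \<comment> \<open>For large x the exponents -\<delta> and \<epsilon> - \<delta> are at most 0,
      so x may be lowered to U.\<close>
    also have "x powr (- \<delta>) * real (pair_count h N d e) + real h * real N * (x powr (\<epsilon> - \<delta>) * x powr (- 1 - \<epsilon>))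
       \<le> U powr (- \<delta>) * real (pair_count h N d e) + real h * real N * (U powr (\<epsilon> - \<delta>) * x powr (- 1 - \<epsilon>))"
      using xU U assms by (intro add_mono mult_right_mono mult_left_mono powr_mono2') auto
    finally have "x powr (- \<delta>) * count_error N d e \<le> U powr (- \<delta>) * real (pair_count h N d e)
       + real h * real N * U powr (\<epsilon> - \<delta>) * x powr (- 1 - \<epsilon>)" by (simp add: mult.assoc)
    moreover have "0 \<le> U powr (1 - \<delta> + \<epsilon>) * x powr (- 1 - \<epsilon>)" by simp
    ultimately show ?thesis unfolding distrib_right by linarith
  qed
  then show ?thesis by (simp add: x_def powr_mult)
qed

text \<open>Sum the pointwise bound over all pairs: the power sums in d and e cost 1 + 1 /
  \<epsilon> each, and the pair counts add up to the second moment estimate.\<close>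

lemma norm_error_le_of_le_1:
  assumes f: "has_abs_convergent_ramanujan_expansion f a"
    and g: "has_abs_convergent_ramanujan_expansion g b"
    and U: "U \<ge> 1" and \<epsilon>: "0 < \<epsilon>" "\<epsilon> \<le> \<delta>" and "\<delta> \<le> 1" "h > 0" "N > 0"
  shows "norm (shifted_convolution_error f a g b h N) \<le>
    M * ((U powr (1 - \<delta> + \<epsilon>) + real h * real N * U powr (\<epsilon> - \<delta>)) * (1 + 1 / \<epsilon>)\<^sup>2
      + U powr (- \<delta>) * (real (N + h) * (1 + ln (real (N + h))) ^ 3))"
proof -
  let ?z = "\<lambda>d::nat. real d powr (- 1 - \<epsilon>)"
  let ?Z = "infsum ?z {0<..}"
  let ?B = "U powr (1 - \<delta> + \<epsilon>) + real h * real N * U powr (\<epsilon> - \<delta>)"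
  let ?S = "\<Sum>d=1..N. \<Sum>e=1..N+h. real (pair_count h N d e)"
  have z: "(?z has_sum ?Z) {0<..}"
    using \<epsilon> by (intro has_sum_infsum summable_on_powr)
  have count: "((\<lambda>(d, e). real (pair_count h N d e)) has_sum ?S) ({0<..} \<times> {0<..})"
  proof (rule has_sum_finite_neutralI[of "{1..N} \<times> {1..N+h}"])
    fix x assume x: "x \<in> {0<..} \<times> {0<..} - {1..N} \<times> {1..N+h}"
    then show "(case x of (d, e) \<Rightarrow> real (pair_count h N d e)) = 0"
      by (cases x) (auto simp: pair_count_def dest!: dvd_imp_le)
  qed (auto simp: sum.cartesian_product)
  let ?w = "\<lambda>x. ?B * (case x of (d, e) \<Rightarrow> ?z d * ?z e) + U powr (- \<delta>) * (case x of (d, e) \<Rightarrow> real (pair_count h N d e))"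
  have w: "(?w has_sum ?B * (?Z * ?Z) + U powr (- \<delta>) * ?S) ({0<..} \<times> {0<..})"
    by (intro has_sum_add has_sum_cmult_right count has_sum_Times_mult_nonneg[OF z z]) auto
  have "norm (shifted_convolution_error f a g b h N) \<le> M * (?B * (?Z * ?Z) + U powr (- \<delta>) * ?S)"
    by (rule norm_error_le[OF f g _ w]) (use weighted_count_error_le[OF U \<epsilon>] assms in simp)
  also have "\<dots> \<le> M * (?B * ((1 + 1 / \<epsilon>) * (1 + 1 / \<epsilon>)) + U powr (- \<delta>) * (real (N + h) * (1 + ln (real (N + h))) ^ 3))"
    using assms by (intro mult_left_mono add_mono mult_mono infsum_powr_le M_nonneg infsum_nonneg sum_pair_count_le) auto
  finally show ?thesis by (simp add: power2_eq_square)
qed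

text \<open>With l = 1 + log N, the power sums cost l^2. Up to constants the three contributions are
  N^(1-\<delta>) times l^(4-2\<delta>), l^(2-2\<delta>) and l^(3-2\<delta>), and the first
  dominates.\<close>

lemma norm_error_le_log_scale:
  assumes f: "has_abs_convergent_ramanujan_expansion f a"
    and g: "has_abs_convergent_ramanujan_expansion g b"
    and "\<delta> \<le> 1" "h > 0" "N > 0"
  shows "norm (shifted_convolution_error f a g b h N) \<le>
    M * (exp (3 * \<delta>) * (1 + real h) * (1 + 1 / \<delta>)\<^sup>2 + (1 + real h) * (1 + ln (1 + real h)) ^ 3)
      * (real N powr (1 - \<delta>) * (1 + ln (real N)) powr (4 - 2 * \<delta>))"
proof -
  \<comment> \<open>Adding 1 ensures that \<open>l\<close> is at least 1 even for N = 1, so powers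
    of \<open>l\<close> increase with the exponent.\<close>
  define l where "l = 1 + ln (real N)"
  \<comment> \<open>\<open>\<epsilon>\<close> is so small that \<open>U powr \<epsilon>\<close> is bounded; the square of the logarithm in \<open>U\<close> balances the two ranges.\<close>
  define U where "U = real N * l\<^sup>2"
  define \<epsilon> where "\<epsilon> = \<delta> / l"
  note \<delta> = A.delta_pos
  have N: "real N \<ge> 1" using assms by simp
  have l: "l \<ge> 1" using N by (simp add: l_def)
  have U: "U \<ge> 1" unfolding U_def using mult_mono[OF N one_le_power[OF l, of 2]] N by simp
  have \<epsilon>: "0 < \<epsilon>" "\<epsilon> \<le> \<delta>"
    using l \<delta> by (auto simp: \<epsilon>_def field_simps)
  have U_eq: "U powr s = real N powr s * l powr (2 * s)" for s
    using N l by (simp add: U_def powr_mult powr_powr flip: powr_numeral)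
  have U\<epsilon>: "U powr \<epsilon> \<le> exp (3 * \<delta>)"
  proof -
    have "ln U = ln (real N) + 2 * ln l"
      using N l by (simp add: U_def ln_mult ln_realpow)
    \<comment> \<open>Here ln N = l - 1, and ln l is at most l - 1.\<close>
    also have "\<dots> \<le> 3 * l" using ln_le_minus_one[of l] l by (simp add: l_def)
    finally have "\<epsilon> * ln U \<le> \<epsilon> * (3 * l)" using \<epsilon> by (intro mult_left_mono) auto
    also have "\<dots> = 3 * \<delta>" using l by (simp add: \<epsilon>_def)
    finally show ?thesis using U by (simp add: powr_def)
  qed
  have pow_le: "l powr s \<le> l powr (4 - 2 * \<delta>)" if "s \<le> 4 - 2 * \<delta>" for s
    using l that by (intro powr_mono) auto
  have Z: "(1 + 1 / \<epsilon>)\<^sup>2 \<le> l powr 2 * (1 + 1 / \<delta>)\<^sup>2"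
  proof -
    have "1 + 1 / \<epsilon> \<le> l * (1 + 1 / \<delta>)" using l \<delta> by (simp add: \<epsilon>_def field_simps)
    then have "(1 + 1 / \<epsilon>)\<^sup>2 \<le> (l * (1 + 1 / \<delta>))\<^sup>2" using \<epsilon> by (intro power_mono) auto
    then show ?thesis using l by (simp add: power_mult_distrib)
  qed
  define R where "R = real N powr (1 - \<delta>) * l powr (4 - 2 * \<delta>)"
  define D where "D = exp (3 * \<delta>) * (1 + 1 / \<delta>)\<^sup>2"
  have D: "D \<ge> 0" by (simp add: D_def)
  have t1: "U powr (1 - \<delta> + \<epsilon>) * (1 + 1 / \<epsilon>)\<^sup>2 \<le> D * R"
  proof -
    have "U powr (1 - \<delta> + \<epsilon>) * (1 + 1 / \<epsilon>)\<^sup>2 = U powr (1 - \<delta>) * (U powr \<epsilon> * (1 + 1 / \<epsilon>)\<^sup>2)"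
      by (simp add: powr_add)
    also have "\<dots> \<le> U powr (1 - \<delta>) * (exp (3 * \<delta>) * (l powr 2 * (1 + 1 / \<delta>)\<^sup>2))"
      using Z U\<epsilon> by (intro mult_left_mono mult_mono) auto
    also have "\<dots> = D * (real N powr (1 - \<delta>) * (l powr (2 * (1 - \<delta>)) * l powr 2))"
      unfolding U_eq D_def by (simp only: mult_ac)
    also have "l powr (2 * (1 - \<delta>)) * l powr 2 = l powr (4 - 2 * \<delta>)"
      by (simp flip: powr_add)
    finally show ?thesis by (simp add: R_def)
  qed
  have t2: "real h * real N * U powr (\<epsilon> - \<delta>) * (1 + 1 / \<epsilon>)\<^sup>2 \<le> real h * (D * R)"
  proof -
    have "real h * real N * U powr (\<epsilon> - \<delta>) * (1 + 1 / \<epsilon>)\<^sup>2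
        = real h * (real N * U powr (- \<delta>) * (U powr \<epsilon> * (1 + 1 / \<epsilon>)\<^sup>2))"
      using powr_add[of U \<epsilon> "- \<delta>"] by simp
    also have "\<dots> \<le> real h * (real N * U powr (- \<delta>) * (exp (3 * \<delta>) * (l powr 2 * (1 + 1 / \<delta>)\<^sup>2)))"
      using Z U\<epsilon> by (intro mult_left_mono mult_mono) auto
    also have "\<dots> = real h * (D * ((real N * real N powr (- \<delta>)) * (l powr (2 * - \<delta>) * l powr 2)))"
      unfolding U_eq D_def by (simp only: mult_ac)
    also have "real N * real N powr (- \<delta>) = real N powr (1 - \<delta>)"
      using N powr_add[of "real N" 1 "- \<delta>"] by simp
    also have "l powr (2 * - \<delta>) * l powr 2 = l powr (2 - 2 * \<delta>)"
      by (simp flip: powr_add)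
    also have "real h * (D * (real N powr (1 - \<delta>) * l powr (2 - 2 * \<delta>))) \<le> real h * (D * R)"
      unfolding R_def using D by (intro mult_left_mono pow_le) auto
    finally show ?thesis .
  qed
  have t3: "U powr (- \<delta>) * (real (N + h) * (1 + ln (real (N + h))) ^ 3)
      \<le> (1 + real h) * (1 + ln (1 + real h)) ^ 3 * R"
  proof -
    have Nh: "real (N + h) \<le> real N * (1 + real h)"
      using N mult_right_mono[of 1 "real N" "real h"] by (simp add: algebra_simps)
    have "ln (real (N + h)) \<le> ln (real N * (1 + real h))"
      using Nh N by (intro ln_mono) auto
    also have "\<dots> = ln (real N) + ln (1 + real h)" using N by (simp add: ln_mult)
    finally have "1 + ln (real (N + h)) \<le> l + 1 * ln (1 + real h)" by (simp add: l_def)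
    also have "\<dots> \<le> l + l * ln (1 + real h)"
      using l by (intro add_left_mono mult_right_mono) auto
    finally have ln_le: "1 + ln (real (N + h)) \<le> l * (1 + ln (1 + real h))" by (simp add: algebra_simps)
    have "U powr (- \<delta>) * (real (N + h) * (1 + ln (real (N + h))) ^ 3)
      \<le> U powr (- \<delta>) * ((real N * (1 + real h)) * (l * (1 + ln (1 + real h))) ^ 3)"
      using N Nh ln_le by (intro mult_left_mono mult_mono power_mono) auto
    also have "\<dots> = (1 + real h) * (1 + ln (1 + real h)) ^ 3 * ((real N * real N powr (- \<delta>)) * (l powr (2 * - \<delta>) * l ^ 3))"
      unfolding U_eq power_mult_distrib by (simp only: mult_ac)
    also have "real N * real N powr (- \<delta>) = real N powr (1 - \<delta>)"
      using N powr_add[of "real N" 1 "- \<delta>"] by simp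
    also have "l ^ 3 = l powr 3" using l by simp
    also have "l powr (2 * - \<delta>) * l powr 3 = l powr (3 - 2 * \<delta>)"
      by (simp flip: powr_add)
    also have "(1 + real h) * (1 + ln (1 + real h)) ^ 3 * (real N powr (1 - \<delta>) * l powr (3 - 2 * \<delta>))
        \<le> (1 + real h) * (1 + ln (1 + real h)) ^ 3 * R"
      unfolding R_def by (intro mult_left_mono pow_le) auto
    finally show ?thesis .
  qed
  have "norm (shifted_convolution_error f a g b h N) \<le>
    M * ((U powr (1 - \<delta> + \<epsilon>) + real h * real N * U powr (\<epsilon> - \<delta>)) * (1 + 1 / \<epsilon>)\<^sup>2
      + U powr (- \<delta>) * (real (N + h) * (1 + ln (real (N + h))) ^ 3))"
    by (rule norm_error_le_of_le_1[OF f g U \<epsilon> assms(3-5)])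
  also have "\<dots> \<le> M * ((D * R + real h * (D * R)) + (1 + real h) * (1 + ln (1 + real h)) ^ 3 * R)"
    unfolding distrib_right[of "U powr (1 - \<delta> + \<epsilon>)"] by (intro mult_left_mono add_mono t1 t2 t3 M_nonneg)
  also have "\<dots> = M * (D * (1 + real h) + (1 + real h) * (1 + ln (1 + real h)) ^ 3) * R"
    by (simp add: algebra_simps)
  finally show ?thesis by (simp add: R_def D_def l_def mult_ac)
qed

text \<open>From N = 2 on, 1 + ln N is at most a constant times ln N. The sign of the constant is
  recorded because a later estimate multiplies by it.\<close>

lemma norm_error_bigo_log:
  assumes f: "has_abs_convergent_ramanujan_expansion f a"
    and g: "has_abs_convergent_ramanujan_expansion g b"
    and "\<delta> \<le> 1" "h > 0"
  shows "\<exists>C\<ge>0. \<forall>N\<ge>2. norm (shifted_convolution_error f a g b h N) \<le>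
    C * (real N powr (1 - \<delta>) * ln (real N) powr (4 - 2 * \<delta>))"
proof -
  define C where "C = M * (exp (3 * \<delta>) * (1 + real h) * (1 + 1 / \<delta>)\<^sup>2 + (1 + real h) * (1 + ln (1 + real h)) ^ 3)"
  \<comment> \<open>Chosen so that 1 is at most ln N / ln 2 for N at least 2.\<close>
  define c where "c = 1 + 1 / ln (2::real)"
  have C: "C \<ge> 0" unfolding C_def by (intro mult_nonneg_nonneg add_nonneg_nonneg M_nonneg) auto
  have c: "c \<ge> 0" by (simp add: c_def)
  have "norm (shifted_convolution_error f a g b h N) \<le>
    C * c powr (4 - 2 * \<delta>) * (real N powr (1 - \<delta>) * ln (real N) powr (4 - 2 * \<delta>))" if N: "N \<ge> 2" for N
  proof -
    have ln2: "ln 2 \<le> ln (real N)" using N by (intro ln_mono) auto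
    then have "1 + ln (real N) \<le> c * ln (real N)" by (simp add: c_def field_simps)
    then have "(1 + ln (real N)) powr (4 - 2 * \<delta>) \<le> (c * ln (real N)) powr (4 - 2 * \<delta>)"
      using N assms by (intro powr_mono2) auto
    also have "\<dots> = c powr (4 - 2 * \<delta>) * ln (real N) powr (4 - 2 * \<delta>)"
      using c N by (simp add: powr_mult)
    finally have "C * (real N powr (1 - \<delta>) * (1 + ln (real N)) powr (4 - 2 * \<delta>))
        \<le> C * (real N powr (1 - \<delta>) * (c powr (4 - 2 * \<delta>) * ln (real N) powr (4 - 2 * \<delta>)))"
      using C by (intro mult_left_mono) auto
    moreover have "norm (shifted_convolution_error f a g b h N) \<le> C * (real N powr (1 - \<delta>) * (1 + ln (real N)) powr (4 - 2 * \<delta>))"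
      unfolding C_def using norm_error_le_log_scale[OF f g assms(3,4), of N] N by simp
    ultimately show ?thesis by (simp only: mult_ac)
  qed
  then show ?thesis using C by (intro exI[of _ "C * c powr (4 - 2 * \<delta>)"]) auto
qed

end

section \<open>The three ranges of \<delta>\<close>

theorem theorem2p3:
  fixes f g fhat ghat :: "nat \<Rightarrow> complex" and \<delta> :: real and h :: nat
  assumes "has_abs_convergent_ramanujan_expansion f fhat"
    and "has_abs_convergent_ramanujan_expansion g ghat"
    and "\<delta> > 0"
    and "\<exists>A. \<forall>r\<ge>1. norm (fhat r) \<le> A * real r powr (- 1 - \<delta>)"
    and "\<exists>B. \<forall>r\<ge>1. norm (ghat r) \<le> B * real r powr (- 1 - \<delta>)"
    and "h \<ge> 1"
  shows "summable (\<lambda>k. fhat (Suc k) * ghat (Suc k) * ramanujan_sum (Suc k) h) \<and>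
    (\<delta> < 1 \<longrightarrow> (\<exists>C. \<forall>N\<ge>2. norm (shifted_convolution_error f fhat g ghat h N)
       \<le> C * (real N powr (1 - \<delta>) * ln (real N) powr (4 - 2 * \<delta>)))) \<and>
    (\<delta> = 1 \<longrightarrow> (\<exists>C. \<forall>N\<ge>2. norm (shifted_convolution_error f fhat g ghat h N)
       \<le> C * ln (real N) ^ 3)) \<and>
    (\<delta> > 1 \<longrightarrow> (\<exists>C. \<forall>N\<ge>2. norm (shifted_convolution_error f fhat g ghat h N) \<le> C))"
proof -
  obtain A where A: "\<And>r. r \<ge> 1 \<Longrightarrow> norm (fhat r) \<le> A * real r powr (- 1 - \<delta>)"
    using assms(4) by blast
  obtain B where B: "\<And>r. r \<ge> 1 \<Longrightarrow> norm (ghat r) \<le> B * real r powr (- 1 - \<delta>)"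
    using assms(5) by blast
  interpret coefficient_pair fhat ghat A B \<delta> h
    by unfold_locales (use A B assms(3) in auto)
  have h: "h > 0" using assms(6) by simp
  have "summable (\<lambda>k. fhat (Suc k) * ghat (Suc k) * ramanujan_sum (Suc k) h)"
    using sums_main_term by (rule sums_summable)
  moreover have "\<exists>C. \<forall>N\<ge>2. norm (shifted_convolution_error f fhat g ghat h N)
       \<le> C * (real N powr (1 - \<delta>) * ln (real N) powr (4 - 2 * \<delta>))" if "\<delta> < 1"
    using norm_error_bigo_log[OF assms(1,2) _ h] that by auto
  moreover have "\<exists>C. \<forall>N\<ge>2. norm (shifted_convolution_error f fhat g ghat h N) \<le> C * ln (real N) ^ 3"
    if \<delta>: "\<delta> = 1"
  proof -
    obtain C where C: "C \<ge> 0" "\<And>N. N \<ge> 2 \<Longrightarrow> norm (shifted_convolution_error f fhat g ghat h N)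
       \<le> C * (real N powr (1 - \<delta>) * ln (real N) powr (4 - 2 * \<delta>))"
      using norm_error_bigo_log[OF assms(1,2) _ h] \<delta> by auto
    \<comment> \<open>At \<delta> = 1 the general bound is of order log^2 N; it is weakened to log^3
      N through ln N / ln 2, which is at least 1.\<close>
    have "norm (shifted_convolution_error f fhat g ghat h N) \<le> C / ln 2 * ln (real N) ^ 3"
      if N: "N \<ge> 2" for N
    proof -
      have ln2: "0 < ln (2::real)" "ln 2 \<le> ln (real N)" using N by auto
      have "ln (real N) ^ 2 * ln 2 \<le> ln (real N) ^ 2 * ln (real N)"
        using ln2(2) by (rule mult_left_mono) simp
      then have "ln (real N) ^ 2 \<le> ln (real N) ^ 3 / ln 2"
        by (simp only: pos_le_divide_eq[OF ln2(1)] power2_eq_square power3_eq_cube)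
      then have "C * ln (real N) ^ 2 \<le> C * (ln (real N) ^ 3 / ln 2)"
        using C(1) by (rule mult_left_mono)
      moreover have "real N powr (1 - \<delta>) * ln (real N) powr (4 - 2 * \<delta>) = ln (real N) ^ 2"
        using \<delta> ln2 N by simp
      ultimately show ?thesis using C(2)[OF N] by simp
    qed
    then show ?thesis by blast
  qed
  moreover have "\<exists>C. \<forall>N\<ge>2. norm (shifted_convolution_error f fhat g ghat h N) \<le> C" if "\<delta> > 1"
    using norm_error_le_of_gt_1[OF assms(1,2) that] by blast
  ultimately show ?thesis by blast
qed

end
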